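(* Let $X_1,\dots,X_n$ be operators in a complex Hilbert space $\mathcal{H}$, each Hermitian or skew-Hermitian, defined on a common invariant domain $D$. Let $m$ be a sequence of positive numbers satisfying (A0), (A1), (A2) and (A3'): there is $L\ge1$ with $p\,m_{p-1}\le L\,m_p$ for all $p\ge1$; set $m^{(1)}=\dots=m^{(n)}=m$ and $\mathbf{m}=(m,\dots,m)$, $\mathbf{X}=(X_1,\dots,X_n)$. If $[X_i,X_j]\in\mathrm{span}\{X_1,\dots,X_n\}$ (on $D$) for every $i,j\in\{1,\dots,n\}$, then $u\in D$ belongs to $\mathcal{S}_{\mathbf{m}}(\mathbf{X})$ if and only if $u\in\bigcap_{j=1}^n\mathcal{S}_m(X_j)$.
   Context: A common invariant domain $D$ means $D\subset\mathrm{Dom}(X_j)$ and $X_jD\subset D$ for all $j$. Notation: $M(n)=\bigcup_{k\ge1}\{1,\dots,n\}^k$; for $\alpha=(i_1,\dots,i_k)$, $|\alpha|=k$, $|\alpha|_j=\mathrm{card}\{l:i_l=j\}$; $\mathbf{X}_\alpha=X_{i_1}\cdots X_{i_k}$; $C^\infty(\mathbf{X})=\{u: u\in\mathrm{Dom}(\mathbf{X}_\alpha)\ \forall\alpha\in M(n)\}$; $\mathbf{m}_\alpha=m^{(1)}_{|\alpha|_1}\cdots m^{(n)}_{|\alpha|_n}$; $\mathcal{S}_{\mathbf{m}}(\mathbf{X})=\{u\in C^\infty(\mathbf{X}):\exists A,C>0,\ \|\mathbf{X}_\alpha u\|\le CA^{|\alpha|}\mathbf{m}_\alpha\ \forall\alpha\in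 M(n)\}$; for a single operator, $\mathcal{S}_m(X_j)=\{u\in C^\infty(X_j):\exists A,C>0,\ \|X_j^ku\|\le CA^km_k\ \forall k\ge1\}$. Conditions: (A0) $m_0=m_1=1$; (A1) $m_p^2\le m_{p-1}m_{p+1}$ for $p\ge1$; (A2) there is $H>0$ with $m_{p+q}\le H^{p+q}m_pm_q$ for all $p,q\in\mathbb{N}$. *)

theory Defs
  imports Complex_Main
begin

text \<open>HOL has no class of complex inner product spaces, so a complex Hilbert space is given
by a carrier type 'h (an abelian group), a complex scalar multiplication smul and an
inner product ip (linear in the first, conjugate-linear in the second argument),
complete with respect to the induced norm.\<close>

definition hnorm :: "('h \<Rightarrow> 'h \<Rightarrow> complex) \<Rightarrow> 'h \<Rightarrow> real" where
  "hnorm ip x = sqrt (Re (ip x x))"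

definition complex_hilbert_space ::
  "(complex \<Rightarrow> 'h::ab_group_add \<Rightarrow> 'h) \<Rightarrow> ('h \<Rightarrow> 'h \<Rightarrow> complex) \<Rightarrow> bool" where
  "complex_hilbert_space smul ip \<longleftrightarrow>
     (\<forall>a x y. smul a (x + y) = smul a x + smul a y) \<and>
     (\<forall>a b x. smul (a + b) x = smul a x + smul b x) \<and>
     (\<forall>a b x. smul a (smul b x) = smul (a * b) x) \<and>
     (\<forall>x. smul 1 x = x) \<and>
     (\<forall>x y. ip x y = cnj (ip y x)) \<and>
     (\<forall>x y z. ip (x + y) z = ip x z + ip y z) \<and>
     (\<forall>a x y. ip (smul a x) y = a * ip x y) \<and>
     (\<forall>x. Re (ip x x) \<ge> 0 \<and> Im (ip x x) = 0) \<and>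
     (\<forall>x. ip x x = 0 \<longrightarrow> x = 0) \<and>
     (\<forall>f :: nat \<Rightarrow> 'h. (\<forall>e>0. \<exists>N. \<forall>p\<ge>N. \<forall>q\<ge>N. hnorm ip (f p - f q) < e) \<longrightarrow>
        (\<exists>l. \<forall>e>0. \<exists>N. \<forall>p\<ge>N. hnorm ip (f p - l) < e))"

definition linear_op_on ::
  "(complex \<Rightarrow> 'h::ab_group_add \<Rightarrow> 'h) \<Rightarrow> 'h set \<Rightarrow> ('h \<Rightarrow> 'h) \<Rightarrow> bool" where
  "linear_op_on smul Dm T \<longleftrightarrow>
     0 \<in> Dm \<and> (\<forall>x\<in>Dm. \<forall>y\<in>Dm. \<forall>a b. smul a x + smul b y \<in> Dm \<and>
        T (smul a x + smul b y) = smul a (T x) + smul b (T y))"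

definition hermitian_on :: "('h \<Rightarrow> 'h \<Rightarrow> complex) \<Rightarrow> 'h set \<Rightarrow> ('h \<Rightarrow> 'h) \<Rightarrow> bool" where
  "hermitian_on ip Dm T \<longleftrightarrow> (\<forall>x\<in>Dm. \<forall>y\<in>Dm. ip (T x) y = ip x (T y))"

definition skew_hermitian_on :: "('h \<Rightarrow> 'h \<Rightarrow> complex) \<Rightarrow> 'h set \<Rightarrow> ('h \<Rightarrow> 'h) \<Rightarrow> bool" where
  "skew_hermitian_on ip Dm T \<longleftrightarrow> (\<forall>x\<in>Dm. \<forall>y\<in>Dm. ip (T x) y = - ip x (T y))"

text \<open>A multi-index alpha = (i_1,...,i_k) is a list [i_1,...,i_k];
X_alpha = X_{i_1} ... X_{i_k} (X_{i_k} is applied first).\<close>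

fun word_app :: "(nat \<Rightarrow> 'h \<Rightarrow> 'h) \<Rightarrow> nat list \<Rightarrow> 'h \<Rightarrow> 'h" where
  "word_app X [] u = u"
| "word_app X (i # as) u = X i (word_app X as u)"

fun word_dom :: "(nat \<Rightarrow> 'h \<Rightarrow> 'h) \<Rightarrow> (nat \<Rightarrow> 'h set) \<Rightarrow> nat list \<Rightarrow> 'h set" where
  "word_dom X Dom [] = UNIV"
| "word_dom X Dom (i # as) = {u \<in> word_dom X Dom as. word_app X as u \<in> Dom i}"

definition Mwords :: "nat \<Rightarrow> nat list set" where
  "Mwords n = {\<alpha>. \<alpha> \<noteq> [] \<and> set \<alpha> \<subseteq> {1..n}}"

definition Cinf :: "nat \<Rightarrow> (nat \<Rightarrow> 'h \<Rightarrow> 'h) \<Rightarrow> (nat \<Rightarrow> 'h set) \<Rightarrow> 'h set" where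
  "Cinf n X Dom = {u. \<forall>\<alpha>\<in>Mwords n. u \<in> word_dom X Dom \<alpha>}"

definition mbold :: "nat \<Rightarrow> (nat \<Rightarrow> nat \<Rightarrow> real) \<Rightarrow> nat list \<Rightarrow> real" where
  "mbold n ms \<alpha> = (\<Prod>j=1..n. ms j (count_list \<alpha> j))"

definition S_multi ::
  "('h \<Rightarrow> 'h \<Rightarrow> complex) \<Rightarrow> nat \<Rightarrow> (nat \<Rightarrow> 'h \<Rightarrow> 'h) \<Rightarrow> (nat \<Rightarrow> 'h set) \<Rightarrow> (nat \<Rightarrow> nat \<Rightarrow> real) \<Rightarrow> 'h set" where
  "S_multi ip n X Dom ms = {u \<in> Cinf n X Dom. \<exists>A>0. \<exists>C>0. \<forall>\<alpha>\<in>Mwords n.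
      hnorm ip (word_app X \<alpha> u) \<le> C * A ^ length \<alpha> * mbold n ms \<alpha>}"

definition Cinf_single :: "('h \<Rightarrow> 'h) \<Rightarrow> 'h set \<Rightarrow> 'h set" where
  "Cinf_single T Dm = {u. \<forall>k. u \<in> word_dom (\<lambda>_. T) (\<lambda>_. Dm) (replicate k 0)}"

definition S_single ::
  "('h \<Rightarrow> 'h \<Rightarrow> complex) \<Rightarrow> ('h \<Rightarrow> 'h) \<Rightarrow> 'h set \<Rightarrow> (nat \<Rightarrow> real) \<Rightarrow> 'h set" where
  "S_single ip T Dm m = {u \<in> Cinf_single T Dm. \<exists>A>0. \<exists>C>0. \<forall>k\<ge>1.
      hnorm ip ((T ^^ k) u) \<le> C * A ^ k * m k}"

end

theory Submission
  imports Defs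
begin

text \<open>Write $w_\alpha = \mathbf{X}_\alpha u$ and suppose $\|X_j^k u\| \le C A^k m_k$. Up to a sign,
$\|w_\alpha\|^2 = \langle X_\gamma u, u\rangle$ with $|\gamma| = 2|\alpha| = 2k$. Let $j$ be the most
frequent letter of $\gamma$ and move all its occurrences to the front: the coefficients this
creates are compensated, up to a factor $C^k$, by the loss in length, thanks to (A3'). In
$\langle X_j^b P u, u\rangle = \pm\langle P u, X_j^b u\rangle$ the word $P$ has length at most
$qk$ with $q = 2 - 1/n$. Hence if $r(k)$ is the best constant with $\|w_\alpha\| \le r(k) m_{|\alpha|}$
for $|\alpha| \le k$, then $\log r(k) \le ck + \frac12 \log r(qk)$. Since $q < 2$, iterating gives
$\log r(k) = O(k)$ as soon as $\log r(k) = O(k \log k)$ is known, and this crude bound follows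
from a discrete maximum principle on words of fixed length. Finally (A2) replaces
$m_{|\alpha|}$ by $\mathbf{m}_\alpha$.\<close>

subsection \<open>Complex inner products\<close>

locale complex_inner =
  fixes smul :: "complex \<Rightarrow> 'h::ab_group_add \<Rightarrow> 'h" and ip :: "'h \<Rightarrow> 'h \<Rightarrow> complex"
  assumes hilbert: "complex_hilbert_space smul ip"
begin

lemma ip_cnj: "ip x y = cnj (ip y x)"
  and ip_add_left: "ip (x + y) z = ip x z + ip y z"
  and ip_smul_left: "ip (smul a x) y = a * ip x y"
  and ip_Re_nonneg: "Re (ip x x) \<ge> 0"
  and ip_Im: "Im (ip x x) = 0"
  and ip_definite: "ip x x = 0 \<Longrightarrow> x = 0"
  using hilbert unfolding complex_hilbert_space_def by blast+

lemma smul_one: "smul 1 x = x"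
  and smul_add_left: "smul (a + b) x = smul a x + smul b x"
  using hilbert unfolding complex_hilbert_space_def by blast+

lemma ip_add_right: "ip x (y + z) = ip x y + ip x z"
  by (metis ip_cnj ip_add_left complex_cnj_add)

lemma ip_smul_right: "ip x (smul a y) = cnj a * ip x y"
  by (metis ip_cnj ip_smul_left complex_cnj_mult)

lemma ip_zero_left [simp]: "ip 0 y = 0"
  using ip_add_left[of 0 0 y] by simp

lemma ip_zero_right [simp]: "ip y 0 = 0"
  using ip_add_right[of y 0 0] by simp

lemma ip_sum_left: "ip (sum f A) y = (\<Sum>k\<in>A. ip (f k) y)"
  by (induction A rule: infinite_finite_induct) (auto simp: ip_add_left)

lemma hnorm_nonneg [simp]: "0 \<le> hnorm ip x"
  by (simp add: hnorm_def ip_Re_nonneg)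

lemma ip_self: "ip x x = complex_of_real ((hnorm ip x)\<^sup>2)"
  by (simp add: complex_eq_iff hnorm_def ip_Re_nonneg ip_Im)

lemma hnorm_zero [simp]: "hnorm ip 0 = 0"
  by (simp add: hnorm_def)

lemma cauchy_schwarz: "cmod (ip x y) \<le> hnorm ip x * hnorm ip y"
proof (cases "hnorm ip y = 0")
  case True
  then have "y = 0" using ip_self[of y] ip_definite by simp
  then show ?thesis by simp
next
  case False
  define b where "b = (hnorm ip y)\<^sup>2"
  have b: "b > 0" using False by (simp add: b_def)
  define t where "t = ip x y / complex_of_real b"
  have "0 \<le> Re (ip (x + smul (- t) y) (x + smul (- t) y))" by (rule ip_Re_nonneg)
  also have "ip (x + smul (- t) y) (x + smul (- t) y)
      = ip x x - cnj t * ip x y - t * cnj (ip x y) + t * cnj t * ip y y"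
    using ip_cnj[of y x] by (simp add: ip_add_left ip_add_right ip_smul_left ip_smul_right algebra_simps)
  also have "\<dots> = complex_of_real ((hnorm ip x)\<^sup>2 - (cmod (ip x y))\<^sup>2 / b)"
    using b unfolding ip_self b_def[symmetric] t_def of_real_diff of_real_divide complex_norm_square
    by (simp add: field_simps)
  finally have "(cmod (ip x y))\<^sup>2 \<le> (hnorm ip x)\<^sup>2 * b" using b by (simp add: field_simps)
  then have "(cmod (ip x y))\<^sup>2 \<le> (hnorm ip x * hnorm ip y)\<^sup>2"
    by (simp add: b_def power_mult_distrib)
  then show ?thesis by (rule power2_le_imp_le) simp
qed

lemma hnorm_triangle: "hnorm ip (x + y) \<le> hnorm ip x + hnorm ip y"
proof (rule power2_le_imp_le)
  have "(hnorm ip (x + y))\<^sup>2 = Re (ip (x + y) (x + y))" by (simp add: ip_self)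
  also have "ip (x + y) (x + y) = ip x x + ip y y + (ip x y + cnj (ip x y))"
    using ip_cnj[of y x] by (simp add: ip_add_left ip_add_right)
  also have "Re \<dots> = (hnorm ip x)\<^sup>2 + (hnorm ip y)\<^sup>2 + 2 * Re (ip x y)"
    by (simp add: ip_self)
  also have "\<dots> \<le> (hnorm ip x + hnorm ip y)\<^sup>2"
    using complex_Re_le_cmod[of "ip x y"] cauchy_schwarz[of x y]
    by (simp add: power2_sum)
  finally show "(hnorm ip (x + y))\<^sup>2 \<le> (hnorm ip x + hnorm ip y)\<^sup>2" .
qed simp

lemma hnorm_smul: "hnorm ip (smul a x) = cmod a * hnorm ip x"
proof -
  have "ip (smul a x) (smul a x) = complex_of_real ((cmod a * hnorm ip x)\<^sup>2)"
    unfolding ip_smul_left ip_smul_right power_mult_distrib of_real_mult complex_norm_square ip_self[of x]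
    by simp
  then show ?thesis by (simp add: hnorm_def[of ip "smul a x"])
qed

lemma hnorm_sum_smul:
  assumes "\<And>k. k \<in> A \<Longrightarrow> hnorm ip (v k) \<le> B"
  shows "hnorm ip (\<Sum>k\<in>A. smul (c k) (v k)) \<le> (\<Sum>k\<in>A. cmod (c k)) * B"
  using assms
proof (induction A rule: infinite_finite_induct)
  case (insert k A)
  have "hnorm ip (\<Sum>k\<in>insert k A. smul (c k) (v k))
      \<le> hnorm ip (smul (c k) (v k)) + hnorm ip (\<Sum>k\<in>A. smul (c k) (v k))"
    using insert.hyps by (simp add: hnorm_triangle)
  also have "\<dots> \<le> cmod (c k) * B + (\<Sum>k\<in>A. cmod (c k)) * B"
    using insert by (intro add_mono) (auto simp: hnorm_smul intro: mult_left_mono)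
  finally show ?case using insert.hyps by (simp add: algebra_simps)
qed simp_all

text \<open>Linearity of \<open>T\<close> is available on \<open>Dm\<close> only, so the induction
  carries membership of the partial sums in \<open>Dm\<close> along with the formula.\<close>

lemma linear_op_on_sum:
  assumes T: "linear_op_on smul Dm T" and v: "\<And>k. k \<in> A \<Longrightarrow> v k \<in> Dm"
  shows "(\<Sum>k\<in>A. smul (c k) (v k)) \<in> Dm
    \<and> T (\<Sum>k\<in>A. smul (c k) (v k)) = (\<Sum>k\<in>A. smul (c k) (T (v k)))"
proof -
  have lin: "smul a x + smul b y \<in> Dm" "T (smul a x + smul b y) = smul a (T x) + smul b (T y)"
    if "x \<in> Dm" "y \<in> Dm" for a b x y
    using T that unfolding linear_op_on_def by blast+
  have zero: "0 \<in> Dm" using T unfolding linear_op_on_def by blast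
  have smul_zero: "smul 0 x = 0" for x using smul_add_left[of 0 0 x] by simp
  have T0: "T 0 = 0" using lin(2)[OF zero zero, of 0 0] by (simp add: smul_zero)
  show ?thesis using v
  proof (induction A rule: infinite_finite_induct)
    case (insert k A)
    define S where "S = (\<Sum>k\<in>A. smul (c k) (v k))"
    have "S \<in> Dm" "T S = (\<Sum>k\<in>A. smul (c k) (T (v k)))" "v k \<in> Dm"
      using insert by (auto simp: S_def)
    then show ?case using insert.hyps lin[of "v k" S "c k" 1] by (simp add: S_def smul_one)
  qed (use zero T0 in simp_all)
qed

lemma linear_op_on_add:
  assumes "linear_op_on smul Dm T" "x \<in> Dm" "y \<in> Dm"
  shows "T (x + y) = T x + T y"
  using assms smul_one unfolding linear_op_on_def by metis

end

subsection \<open>Words and inversions\<close>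

abbreviation nwords :: "nat \<Rightarrow> nat list set" where
  "nwords n \<equiv> {\<alpha>. set \<alpha> \<subseteq> {1..n}}"

text \<open>Number of pairs formed by a letter other than \<open>j\<close> and a later occurrence of
  \<open>j\<close>. It vanishes exactly when all occurrences of \<open>j\<close> stand in front, and
  an adjacent swap moving \<open>j\<close> to the left lowers it by one.\<close>

fun inversions :: "'a \<Rightarrow> 'a list \<Rightarrow> nat" where
  "inversions j [] = 0"
| "inversions j (i # xs) = (if i = j then 0 else count_list xs j) + inversions j xs"

lemma inversions_append:
  "inversions j (xs @ ys) = inversions j xs + inversions j ys
     + length (filter (\<lambda>i. i \<noteq> j) xs) * count_list ys j"
  by (induction xs) auto

text \<open>Each letter adds at most the length of the rest. Quadratic order suffices: a factor
  \<open>1 + \<kappa> * L / K\<close> per inversion amounts to at most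
  \<open>exp (\<kappa> * L * K)\<close> for a word of length \<open>K\<close>.\<close>

lemma inversions_le: "inversions j xs \<le> length xs * length xs"
proof (induction xs)
  case (Cons i xs)
  have "inversions j (i # xs) \<le> length xs + length xs * length xs"
    using Cons count_le_length[of xs j] by simp
  also have "\<dots> \<le> length (i # xs) * length (i # xs)" by simp
  finally show ?case .
qed simp

text \<open>The dichotomy behind the reordering: either a swap lowering \<open>inversions j\<close>
  is possible, or the word is already in normal form.\<close>

lemma adjacent_inversion_or_front:
  "(\<exists>P i Q. i \<noteq> j \<and> xs = P @ i # j # Q) \<or> (\<exists>b P. xs = replicate b j @ P \<and> j \<notin> set P)"
proof (induction xs)
  case (Cons x xs)
  from Cons.IH show ?case
  proof (elim disjE exE conjE)
    fix P i Q assume "i \<noteq> j" "xs = P @ i # j # Q"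
    then have "x # xs = (x # P) @ i # j # Q" by simp
    then show ?thesis using \<open>i \<noteq> j\<close> by blast
  next
    fix b P assume xs: "xs = replicate b j @ P" "j \<notin> set P"
    show ?thesis
    proof (cases "x = j")
      case True
      then have "x # xs = replicate (Suc b) j @ P" using xs by simp
      then show ?thesis using xs by blast
    next
      case False
      show ?thesis
      proof (cases b)
        case 0
        then have "x # xs = replicate 0 j @ (x # P)" "j \<notin> set (x # P)" using xs False by auto
        then show ?thesis by blast
      next
        case (Suc b')
        then have "x # xs = [] @ x # j # (replicate b' j @ P)" using xs by simp
        then show ?thesis using False by blast
      qed
    qed
  qed
qed simp

text \<open>Pigeonhole: if every letter of \<open>A\<close> failed the bound, the counts would add
  up to less than \<open>length xs\<close>.\<close>

lemma frequent_letter: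
  assumes "set xs \<subseteq> A" "finite A" "A \<noteq> {}"
  obtains j where "j \<in> A" "length xs \<le> card A * count_list xs j"
proof (rule ccontr)
  assume "\<not> thesis"
  then have less: "card A * count_list xs j < length xs" if "j \<in> A" for j
    using that \<open>\<And>j. \<lbrakk>j \<in> A; length xs \<le> card A * count_list xs j\<rbrakk> \<Longrightarrow> thesis\<close> not_le by blast
  have "(\<Sum>j\<in>A. card A * count_list xs j) < (\<Sum>j\<in>A. length xs)"
    using less assms by (intro sum_strict_mono) auto
  then show False
    using sum_count_set[OF assms(1,2)] by (simp add: sum_distrib_left[symmetric])
qed

lemma finite_nwords: "finite {\<alpha> \<in> nwords n. length \<alpha> = k}"
  using finite_lists_length_eq[of "{1..n}" k] by (simp add: conj_commute)

section \<open>Convexity of the squared letter counts\<close>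

definition sq_counts :: "nat \<Rightarrow> nat list \<Rightarrow> real" where
  "sq_counts n \<alpha> = (\<Sum>l=1..n. (real (count_list \<alpha> l))\<^sup>2)"

text \<open>Replacing \<open>i\<close> by \<open>j\<close> shifts the vector of counts by
  \<open>d\<close>, the opposite replacement by \<open>- d\<close>. The parallelogram identity
  applies, and \<open>d\<close> has squared length 2.\<close>

lemma sq_counts_exchange:
  assumes "i \<in> {1..n}" "j \<in> {1..n}" "i \<noteq> j"
    and \<alpha>: "\<alpha> = P1 @ i # P2" "\<alpha> = Q1 @ j # Q2"
  shows "sq_counts n (j # P1 @ P2) + sq_counts n (i # Q1 @ Q2) = 2 * sq_counts n \<alpha> + 4"
proof -
  define d where "d l = (if l = j then 1 else 0) - (if l = i then 1 else 0 :: real)" for l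
  have 1: "real (count_list (j # P1 @ P2) l) = real (count_list \<alpha> l) + d l" for l
    using assms(3) by (auto simp: \<alpha>(1) d_def)
  have 2: "real (count_list (i # Q1 @ Q2) l) = real (count_list \<alpha> l) - d l" for l
    using assms(3) by (auto simp: \<alpha>(2) d_def)
  have "(\<Sum>l=1..n. (d l)\<^sup>2) = (\<Sum>l=1..n. (if l = j then 1 else 0) + (if l = i then 1 else 0))"
    using assms(3) by (intro sum.cong) (auto simp: d_def)
  also have "\<dots> = 2" using assms(1,2) by (simp add: sum.distrib)
  finally have d2: "(\<Sum>l=1..n. (d l)\<^sup>2) = 2" .
  have "sq_counts n (j # P1 @ P2) + sq_counts n (i # Q1 @ Q2)
      = (\<Sum>l=1..n. 2 * (real (count_list \<alpha> l))\<^sup>2 + 2 * (d l)\<^sup>2)"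
    unfolding sq_counts_def 1 2 sum.distrib[symmetric]
    by (intro sum.cong) (auto simp: power2_eq_square algebra_simps)
  also have "\<dots> = 2 * sq_counts n \<alpha> + 2 * (\<Sum>l=1..n. (d l)\<^sup>2)"
    by (simp add: sq_counts_def sum.distrib sum_distrib_left)
  finally show ?thesis unfolding d2 by simp
qed

lemma sq_counts_replicate:
  assumes "j \<in> {1..n}"
  shows "sq_counts n (replicate k j) = (real k)\<^sup>2"
proof -
  have cnt: "count_list (replicate k j) l = (if l = j then k else 0)" for l
    by (induction k) auto
  have "sq_counts n (replicate k j) = (\<Sum>l=1..n. if l = j then (real k)\<^sup>2 else 0)"
    unfolding sq_counts_def cnt by (intro sum.cong) auto
  then show ?thesis using assms by simp
qed

subsection \<open>Weight sequences\<close>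

locale log_convex_weight =
  fixes m :: "nat \<Rightarrow> real"
  assumes pos: "m p > 0"
    and normalized: "m 0 = 1" "m 1 = 1"
    and log_convex: "p \<ge> 1 \<Longrightarrow> (m p)\<^sup>2 \<le> m (p - 1) * m (p + 1)"
begin

lemma ratio_mono:
  assumes "p \<le> q"
  shows "m (Suc p) / m p \<le> m (Suc q) / m q"
  using assms
proof (induction q rule: dec_induct)
  case (step q)
  have "m (Suc q) * m (Suc q) \<le> m q * m (Suc (Suc q))"
    using log_convex[of "Suc q"] by (simp add: power2_eq_square)
  then have "m (Suc q) / m q \<le> m (Suc (Suc q)) / m (Suc q)"
    using pos[of q] pos[of "Suc q"] by (simp add: field_simps)
  with step show ?case by linarith
qed simp

text \<open>Raising \<open>p\<close> by one multiplies the left side by the quotient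
  \<open>m (Suc p) / m p\<close> and the right side by the quotient at \<open>p + q\<close>, which
  is at least as large.\<close>

lemma supermultiplicative: "m p * m q \<le> m (p + q)"
proof (induction p)
  case (Suc p)
  have "m (Suc p) * m q = (m (Suc p) / m p) * (m p * m q)" using pos[of p] by simp
  also have "\<dots> \<le> (m (Suc (p + q)) / m (p + q)) * m (p + q)"
    using Suc pos by (intro mult_mono ratio_mono) (auto intro: less_imp_le)
  also have "\<dots> = m (Suc p + q)" using pos[of "p + q"] by simp
  finally show ?case .
qed (simp add: normalized)

lemma ge_one: "m p \<ge> 1"
proof (induction p)
  case (Suc p)
  then show ?case using supermultiplicative[of p 1] normalized by simp
qed (simp add: normalized)

end

text \<open>One summand is split off at a time, and each of the \<open>card S\<close> splittings
  costs at most \<open>H\<close> to the power of the whole sum. Applied to letter counts, this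
  passes from the weight of the length of a word to the product of the weights of its
  counts.\<close>

lemma weight_sum_le:
  fixes m :: "nat \<Rightarrow> real"
  assumes "H \<ge> 1" and pos: "\<And>p. m p > 0" and "m 0 = 1"
    and submult: "\<And>p q. m (p + q) \<le> H ^ (p + q) * m p * m q"
    and "finite S"
  shows "m (sum f S) \<le> H ^ (card S * sum f S) * (\<Prod>l\<in>S. m (f l))"
  using \<open>finite S\<close>
proof induction
  case (insert x S)
  let ?N = "f x + sum f S"
  have prod_nonneg: "0 \<le> (\<Prod>l\<in>S. m (f l))" by (intro prod_nonneg) (auto intro: less_imp_le pos)
  have "m ?N \<le> H ^ ?N * m (f x) * m (sum f S)" by (rule submult)
  also have "\<dots> \<le> H ^ ?N * m (f x) * (H ^ (card S * ?N) * (\<Prod>l\<in>S. m (f l)))"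
  proof (rule mult_left_mono)
    have "m (sum f S) \<le> H ^ (card S * sum f S) * (\<Prod>l\<in>S. m (f l))" by (rule insert.IH)
    also have "\<dots> \<le> H ^ (card S * ?N) * (\<Prod>l\<in>S. m (f l))"
      using \<open>H \<ge> 1\<close> prod_nonneg by (intro mult_right_mono power_increasing) auto
    finally show "m (sum f S) \<le> \<dots>" .
  qed (use \<open>H \<ge> 1\<close> pos in \<open>auto intro: less_imp_le\<close>)
  finally show ?case using insert.hyps by (simp add: power_add mult_ac)
qed (use assms in simp)

text \<open>A single term of the exponential series at \<open>K\<close> is at most its sum.\<close>

lemma power_self_le_exp_fact: "real K ^ K \<le> exp (real K) * fact K"
proof -
  have "(\<Sum>i\<in>{K}. inverse (fact i) *\<^sub>R real K ^ i) \<le> (\<Sum>i. inverse (fact i) *\<^sub>R real K ^ i)"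
    by (intro sum_le_suminf summable_exp_generic) auto
  then show ?thesis by (simp add: exp_def field_simps)
qed

text \<open>Iterating \<open>growth\<close> gives the factor
  \<open>L ^ l * fact (K - l) / fact K\<close>. Bounding the quotient of factorials turns it into a
  gain of \<open>L / K\<close> per lost index, at the single price \<open>exp (real K)\<close>. This
  gain pays for the commutators created when a word of length \<open>K\<close> is reordered.\<close>

lemma weight_lowering:
  fixes m :: "nat \<Rightarrow> real"
  assumes L: "L \<ge> 1" and pos: "\<And>p. m p > 0"
    and growth: "\<And>p. p \<ge> 1 \<Longrightarrow> real p * m (p - 1) \<le> L * m p"
    and "l \<le> K" "K \<ge> 1"
  shows "m (K - l) \<le> exp (real K) * (L / real K) ^ l * m K"
proof -
  have 1: "fact K * m (K - l) \<le> L ^ l * fact (K - l) * m K" using \<open>l \<le> K\<close>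
  proof (induction l)
    case (Suc l)
    define p where "p = K - l"
    have p: "p \<ge> 1" "K - Suc l = p - 1" using Suc.prems by (auto simp: p_def)
    have f: "fact p = real p * fact (p - 1)" using p by (simp add: fact_reduce)
    have "real p * (fact K * m (p - 1)) \<le> fact K * (L * m p)"
      using growth[OF p(1)] by (simp add: mult_left_mono mult.left_commute)
    also have "\<dots> \<le> L * (L ^ l * fact p * m K)"
      using Suc L by (simp add: p_def mult_left_mono mult.left_commute)
    finally have "real p * (fact K * m (p - 1)) \<le> real p * (L ^ Suc l * fact (p - 1) * m K)"
      by (simp add: f mult_ac)
    then show ?case using p by simp
  qed simp
  have "(fact (K - l) :: real) \<le> real (K - l) ^ (K - l)" 
    by (metis fact_le_power of_nat_fact of_nat_power order_refl of_nat_le_iff)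
  also have "\<dots> \<le> real K ^ (K - l)" by (intro power_mono) auto
  finally have "fact (K - l) * real K ^ l \<le> real K ^ (K - l) * real K ^ l"
    by (intro mult_right_mono) auto
  also have "\<dots> = real K ^ K" using \<open>l \<le> K\<close> by (simp add: power_add[symmetric])
  also have "\<dots> \<le> exp (real K) * fact K" by (rule power_self_le_exp_fact)
  finally have 2: "fact (K - l) \<le> exp (real K) * fact K / real K ^ l"
    using \<open>K \<ge> 1\<close> by (simp add: field_simps)
  have "fact K * m (K - l) \<le> L ^ l * fact (K - l) * m K" by (rule 1)
  also have "\<dots> \<le> L ^ l * (exp (real K) * fact K / real K ^ l) * m K"
    using L pos[of K] by (intro mult_right_mono mult_left_mono 2) auto
  also have "\<dots> = fact K * (exp (real K) * (L / real K) ^ l * m K)"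
    by (simp add: power_divide)
  finally show ?thesis by simp
qed

subsection \<open>Bootstrapping a growth estimate\<close>

text \<open>Iterating the step, $i$ applications trade the scale $x$ for $q^i x$ but divide the
unknown exponent by $2^i$; as $q < 2$, an a priori bound of order $x \log x$ is negligible in
the limit.\<close>

lemma bootstrap:
  fixes B :: "real \<Rightarrow> real \<Rightarrow> bool" and q c C :: real
  assumes q: "1 \<le> q" "q < 2"
    and step: "\<And>s x. x \<ge> 1 \<Longrightarrow> B s (q * x) \<Longrightarrow> B ((c * x + s) / 2) x"
    and apriori: "\<And>x. x \<ge> 1 \<Longrightarrow> B (C * x * (1 + ln x)) x"
    and mono: "\<And>s s' x. B s x \<Longrightarrow> s \<le> s' \<Longrightarrow> B s' x"
    and x: "x \<ge> 1" and "c \<ge> 0"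
  shows "B (c / (2 - q) * x + 1) x"
proof -
  define r where "r = q / 2"
  have r: "0 \<le> r" "r < 1" using q by (auto simp: r_def)
  \<comment> \<open>The accumulated costs are the terms \<open>c * x / 2 * r ^ l\<close> for
    \<open>l < i\<close>, a geometric series; note \<open>2 * (1 - r) = 2 - q\<close>.\<close>
  have iterate: "B (s / 2 ^ i + c * x * (1 - r ^ i) / (2 - q)) x" if "B s (q ^ i * x)" for s i
    using that
  proof (induction i arbitrary: s)
    case (Suc i)
    have "1 \<le> q ^ i * x" using q x by (metis mult_mono' mult_1 one_le_power zero_le_one)
    then have "B ((c * (q ^ i * x) + s) / 2) (q ^ i * x)"
      using step[of "q ^ i * x" s] Suc.prems by (simp add: mult_ac)
    from Suc.IH[OF this]
    have "B ((c * (q ^ i * x) + s) / 2 / 2 ^ i + c * x * (1 - r ^ i) / (2 - q)) x" .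
    also have "(c * (q ^ i * x) + s) / 2 / 2 ^ i + c * x * (1 - r ^ i) / (2 - q)
       = s / 2 ^ Suc i + c * x * (r ^ i / 2 + (1 - r ^ i) / (2 - q))"
      using q by (simp add: r_def power_divide field_simps)
    also have "r ^ i / 2 + (1 - r ^ i) / (2 - q) = (1 - r ^ Suc i) / (2 - q)"
      using q by (simp add: r_def field_simps)
    finally show ?case by simp
  qed simp
  \<comment> \<open>This is the a priori exponent at scale \<open>q ^ i * x\<close>, divided by
    \<open>2 ^ i\<close>. Its logarithm grows only linearly in \<open>i\<close>, which
    \<open>r ^ i\<close> beats; some value below 1 yields the \<open>+ 1\<close> of the
    conclusion.\<close>
  have "(\<lambda>i. C * x * ((1 + ln x) * r ^ i + ln q * (real i * r ^ i))) \<longlonglongrightarrow>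
      C * x * ((1 + ln x) * 0 + ln q * 0)"
    using r powser_times_n_limit_0[of r] by (intro tendsto_intros LIMSEQ_power_zero) auto
  then have "eventually (\<lambda>i. C * x * ((1 + ln x) * r ^ i + ln q * (real i * r ^ i)) < 1) sequentially"
    by (rule order_tendstoD) simp
  then obtain i where i: "C * x * ((1 + ln x) * r ^ i + ln q * (real i * r ^ i)) < 1"
    using eventually_happens by force
  define z where "z = q ^ i * x"
  have z: "z \<ge> 1" using q x unfolding z_def by (metis mult_mono' mult_1 one_le_power zero_le_one)
  have "ln z = real i * ln q + ln x" using q x by (simp add: z_def ln_mult ln_realpow)
  then have "C * z * (1 + ln z) / 2 ^ i = C * x * ((1 + ln x) * r ^ i + ln q * (real i * r ^ i))"
    by (simp add: z_def r_def power_divide field_simps)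
  with i have small: "C * z * (1 + ln z) / 2 ^ i \<le> 1" by simp
  have "c * x * (1 - r ^ i) / (2 - q) \<le> c * x * 1 / (2 - q)"
    using r q x \<open>c \<ge> 0\<close> by (intro divide_right_mono mult_left_mono) auto
  also have "c * x * 1 / (2 - q) = c / (2 - q) * x" by simp
  finally have "C * z * (1 + ln z) / 2 ^ i + c * x * (1 - r ^ i) / (2 - q) \<le> c / (2 - q) * x + 1"
    using small by linarith
  with iterate[OF apriori[OF z, unfolded z_def], folded z_def] show ?thesis
    by (rule mono)
qed


subsection \<open>Words of operators spanning a Lie algebra\<close>

text \<open>Here \<open>w \<alpha>\<close> plays the role of $\mathbf{X}_\alpha u$ for a fixed vector $u$.\<close>

locale lie_words = complex_inner smul ip
  for smul :: "complex \<Rightarrow> 'h::ab_group_add \<Rightarrow> 'h" and ip +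
  fixes n :: nat and w :: "nat list \<Rightarrow> 'h" and c :: "nat \<Rightarrow> nat \<Rightarrow> nat \<Rightarrow> complex"
    and eps :: "nat \<Rightarrow> complex" and \<kappa> :: real
  assumes swap: "set P \<subseteq> {1..n} \<Longrightarrow> set Q \<subseteq> {1..n} \<Longrightarrow> i \<in> {1..n} \<Longrightarrow> j \<in> {1..n} \<Longrightarrow>
      w (P @ i # j # Q) = w (P @ j # i # Q) + (\<Sum>k=1..n. smul (c i j k) (w (P @ k # Q)))"
    and adjoint: "i \<in> {1..n} \<Longrightarrow> set P \<subseteq> {1..n} \<Longrightarrow> set Q \<subseteq> {1..n} \<Longrightarrow>
      ip (w (i # P)) (w Q) = eps i * ip (w P) (w (i # Q))"
    and eps: "eps i = 1 \<or> eps i = - 1"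
    and kappa: "i \<in> {1..n} \<Longrightarrow> j \<in> {1..n} \<Longrightarrow> (\<Sum>k=1..n. cmod (c i j k)) \<le> \<kappa>"
    and kappa_ge_1: "\<kappa> \<ge> 1"
begin

section \<open>Adjoints and commutators of words\<close>

lemma cmod_adjoint:
  "i \<in> {1..n} \<Longrightarrow> set P \<subseteq> {1..n} \<Longrightarrow> set Q \<subseteq> {1..n} \<Longrightarrow>
    cmod (ip (w (i # P)) (w Q)) = cmod (ip (w P) (w (i # Q)))"
  using adjoint[of i P Q] eps[of i] by auto

text \<open>Letters leave \<open>\<alpha>\<close> from the left, so they arrive on the other side in
  reverse order; the signs \<open>eps\<close> disappear in the modulus.\<close>

lemma cmod_adjoint_word:
  "set \<alpha> \<subseteq> {1..n} \<Longrightarrow> set \<beta> \<subseteq> {1..n} \<Longrightarrow> set \<gamma> \<subseteq> {1..n} \<Longrightarrow>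
    cmod (ip (w (\<alpha> @ \<beta>)) (w \<gamma>)) = cmod (ip (w \<beta>) (w (rev \<alpha> @ \<gamma>)))"
  by (induction \<alpha> arbitrary: \<gamma>) (auto simp: cmod_adjoint)

lemma commutator_norm:
  assumes "set P \<subseteq> {1..n}" "set Q \<subseteq> {1..n}" "i \<in> {1..n}" "j \<in> {1..n}"
    and a: "\<And>\<beta>. set \<beta> \<subseteq> {1..n} \<Longrightarrow> length \<beta> = Suc (length P + length Q) \<Longrightarrow> hnorm ip (w \<beta>) \<le> a"
  shows "hnorm ip (\<Sum>k=1..n. smul (c i j k) (w (P @ k # Q))) \<le> \<kappa> * a"
proof -
  have "0 \<le> a" using assms(1-3) by (intro order_trans[OF hnorm_nonneg a[of "P @ i # Q"]]) auto
  have "hnorm ip (\<Sum>k=1..n. smul (c i j k) (w (P @ k # Q))) \<le> (\<Sum>k=1..n. cmod (c i j k)) * a"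
    using assms(1,2) by (intro hnorm_sum_smul a) auto
  also have "\<dots> \<le> \<kappa> * a" using kappa assms \<open>0 \<le> a\<close> by (intro mult_right_mono) auto
  finally show ?thesis .
qed

text \<open>The letter \<open>i\<close> passes the letters of \<open>P\<close> one by one, starting
  with the last. Each passage leaves a commutator made of words one letter shorter.\<close>

lemma move_front:
  assumes "set P \<subseteq> {1..n}" "set Q \<subseteq> {1..n}" "i \<in> {1..n}"
    and "\<And>\<beta>. set \<beta> \<subseteq> {1..n} \<Longrightarrow> length \<beta> = length P + length Q \<Longrightarrow> hnorm ip (w \<beta>) \<le> a"
  shows "hnorm ip (w (P @ i # Q) - w (i # P @ Q)) \<le> real (length P) * (\<kappa> * a)"
  using assms
proof (induction P arbitrary: Q rule: rev_induct)
  case (snoc p P)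
  have "hnorm ip (w (P @ p # i # Q) - w (P @ i # p # Q)) \<le> \<kappa> * a"
    using swap[of P Q p i] commutator_norm[of P Q p i a] snoc.prems by simp
  moreover have "hnorm ip (w (P @ i # p # Q) - w (i # P @ p # Q)) \<le> real (length P) * (\<kappa> * a)"
    using snoc.prems by (intro snoc.IH) auto
  ultimately show ?case
    using hnorm_triangle[of "w (P @ p # i # Q) - w (P @ i # p # Q)"
        "w (P @ i # p # Q) - w (i # P @ p # Q)"]
    by (simp add: algebra_simps)
qed simp

section \<open>A priori bound by a maximum principle\<close>

text \<open>Maximum principle: if $\alpha$ contains letters $i \neq j$, exchanging one of each between
the two factors of $\langle w_\alpha, w_\alpha\rangle$ bounds $\|w_\alpha\|^2$ by the mean of its
values at the two neighbours of $\alpha$ in direction $\pm(e_i - e_j)$, up to shorter words. The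
strictly convex term \<open>sq_counts\<close> absorbs these errors, so the maximum sits at a pure power.\<close>

lemma maximum_principle:
  assumes k: "k \<ge> 1" and e: "\<And>j. j \<in> {1..n} \<Longrightarrow> hnorm ip (w (replicate k j)) \<le> e"
    and a: "\<And>\<beta>. set \<beta> \<subseteq> {1..n} \<Longrightarrow> length \<beta> = k \<Longrightarrow> hnorm ip (w \<beta>) \<le> a"
    and a': "\<And>\<beta>. set \<beta> \<subseteq> {1..n} \<Longrightarrow> length \<beta> = k - 1 \<Longrightarrow> hnorm ip (w \<beta>) \<le> a'"
    and \<alpha>: "set \<alpha> \<subseteq> {1..n}" "length \<alpha> = k"
  shows "(hnorm ip (w \<alpha>))\<^sup>2 \<le> e\<^sup>2 + (real k)\<^sup>2 * ((2 * real k + 1) * \<kappa> * a' * a + 1)"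
proof -
  have "set (tl \<alpha>) \<subseteq> {1..n}" using \<alpha> list.set_sel(2)[of \<alpha>] by (cases \<alpha>) auto
  then have a'_nonneg: "0 \<le> a'"
    using \<alpha> by (intro order_trans[OF hnorm_nonneg a'[of "tl \<alpha>"]]) auto
  have a_nonneg: "0 \<le> a" by (rule order_trans[OF hnorm_nonneg a[OF \<alpha>]])
  \<comment> \<open>\<open>E\<close> exceeds by 1 the total error of one exchange:
    \<open>k * \<kappa> * a' * a\<close> for each of the two moves to the front, and
    \<open>\<kappa> * a' * a\<close> for the swap.\<close>
  define E where "E = (2 * real k + 1) * \<kappa> * a' * a + 1"
  have E: "E > 0" using a_nonneg a'_nonneg kappa_ge_1 by (simp add: E_def add_nonneg_pos)
  define S where "S = {\<beta> \<in> nwords n. length \<beta> = k}"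
  define g where "g \<beta> = (hnorm ip (w \<beta>))\<^sup>2 + E * sq_counts n \<beta>" for \<beta>
  have S: "finite S" "\<alpha> \<in> S" unfolding S_def using finite_nwords \<alpha> by auto
  then have "Max (g ` S) \<in> g ` S" by (intro Max_in) auto
  then obtain \<beta> where \<beta>: "\<beta> \<in> S" "g \<beta> = Max (g ` S)" by auto
  have max: "g \<gamma> \<le> g \<beta>" if "\<gamma> \<in> S" for \<gamma> using that S \<beta> by simp
  have \<beta>n: "set \<beta> \<subseteq> {1..n}" "length \<beta> = k" using \<beta>(1) by (auto simp: S_def)
  obtain i \<beta>' where \<beta>_Cons: "\<beta> = i # \<beta>'" using \<beta>n k by (cases \<beta>) auto
  have "\<forall>j\<in>set \<beta>. j = i"
  proof (rule ccontr)
    assume "\<not> ?thesis"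
    then obtain j where j: "j \<in> set \<beta>" "j \<noteq> i" by blast
    have i: "i \<in> set \<beta>" by (simp add: \<beta>_Cons)
    have ij: "i \<in> {1..n}" "j \<in> {1..n}" using i j \<beta>n by auto
    obtain P1 P2 where P12: "\<beta> = P1 @ i # P2" using split_list[OF i] by blast
    obtain Q1 Q2 where Q12: "\<beta> = Q1 @ j # Q2" using split_list[OF j(1)] by blast
    define P Q where "P = P1 @ P2" and "Q = Q1 @ Q2"
    have P: "set P \<subseteq> {1..n}" "length P = k - 1" using \<beta>n P12 by (auto simp: P_def)
    have Q: "set Q \<subseteq> {1..n}" "length Q = k - 1" using \<beta>n Q12 by (auto simp: Q_def)
    define d1 d2 where "d1 = w \<beta> - w (i # P)" and "d2 = w \<beta> - w (j # Q)"
    have move: "hnorm ip (w \<beta> - w (l # R1 @ R2)) \<le> k * (\<kappa> * a')"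
      if "\<beta> = R1 @ l # R2" "l \<in> {1..n}" for l R1 R2
    proof -
      have "hnorm ip (w \<beta> - w (l # R1 @ R2)) \<le> real (length R1) * (\<kappa> * a')"
        unfolding that(1) using \<beta>n that by (intro move_front a') auto
      also have "\<dots> \<le> k * (\<kappa> * a')"
        using \<beta>n that a'_nonneg kappa_ge_1 by (intro mult_right_mono) auto
      finally show ?thesis .
    qed
    have d: "hnorm ip d1 \<le> k * (\<kappa> * a')" "hnorm ip d2 \<le> k * (\<kappa> * a')"
      using move[OF P12] move[OF Q12] ij by (auto simp: d1_def d2_def P_def Q_def)
    let ?R = "\<Sum>l=1..n. smul (c i j l) (w (l # Q))"
    have "w \<beta> = w (i # P) + d1" "w \<beta> = w (j # Q) + d2" by (simp_all add: d1_def d2_def)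
    then have split: "ip (w \<beta>) (w \<beta>) = ip (w (i # P)) (w (j # Q)) + ip (w (i # P)) d2 + ip d1 (w \<beta>)"
      using ip_add_left[of "w (i # P)" d1 "w \<beta>"] ip_add_right[of "w (i # P)" "w (j # Q)" d2]
      by simp
    have iP: "hnorm ip (w (i # P)) \<le> a" using a[of "i # P"] P ij k by simp
    have t1: "cmod (ip (w (i # P)) d2) \<le> a * (k * (\<kappa> * a'))"
      using cauchy_schwarz[of "w (i # P)" d2] mult_mono[OF iP d(2) a_nonneg hnorm_nonneg]
      by linarith
    have t2: "cmod (ip d1 (w \<beta>)) \<le> k * (\<kappa> * a') * a"
      using cauchy_schwarz[of d1 "w \<beta>"] mult_mono[OF d(1) a[OF \<beta>n] _ hnorm_nonneg]
        a'_nonneg kappa_ge_1 by fastforce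
    have R: "hnorm ip ?R \<le> \<kappa> * a"
      using commutator_norm[of "[]" Q i j a] a Q ij k by simp
    \<comment> \<open>The letter \<open>i\<close> goes to the right factor and is swapped with
      \<open>j\<close>, and then \<open>j\<close> returns to the left factor.\<close>
    have "cmod (ip (w (i # P)) (w (j # Q))) = cmod (ip (w P) (w (i # j # Q)))"
      using P Q ij by (simp add: cmod_adjoint)
    also have "\<dots> = cmod (ip (w P) (w (j # i # Q)) + ip (w P) ?R)"
      using swap[of "[]" Q i j] Q ij by (simp add: ip_add_right)
    also have "\<dots> \<le> cmod (ip (w (j # P)) (w (i # Q))) + cmod (ip (w P) ?R)"
      using P Q ij norm_triangle_ineq by (simp add: cmod_adjoint)
    also have "\<dots> \<le> hnorm ip (w (j # P)) * hnorm ip (w (i # Q)) + a' * (\<kappa> * a)"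
      using cauchy_schwarz[of "w P" ?R] mult_mono[OF a'[OF P] R a'_nonneg hnorm_nonneg]
      by (intro add_mono cauchy_schwarz) linarith
    finally have t3: "cmod (ip (w (i # P)) (w (j # Q)))
      \<le> hnorm ip (w (j # P)) * hnorm ip (w (i # Q)) + a' * (\<kappa> * a)" .
    have "(hnorm ip (w \<beta>))\<^sup>2 = cmod (ip (w \<beta>) (w \<beta>))" by (simp add: ip_self norm_power)
    also have "\<dots> \<le> cmod (ip (w (i # P)) (w (j # Q))) + cmod (ip (w (i # P)) d2)
        + cmod (ip d1 (w \<beta>))"
      unfolding split by (intro norm_triangle_mono norm_triangle_ineq order_refl)
    also have "\<dots> \<le> hnorm ip (w (j # P)) * hnorm ip (w (i # Q)) + E - 1"
      using t1 t2 t3 by (simp add: E_def algebra_simps)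
    finally have upper: "(hnorm ip (w \<beta>))\<^sup>2
      \<le> hnorm ip (w (j # P)) * hnorm ip (w (i # Q)) + E - 1" .
    have "g (j # P) \<le> g \<beta>" "g (i # Q) \<le> g \<beta>"
      using P Q ij k by (auto intro!: max simp: S_def)
    moreover have "E * sq_counts n (j # P) + E * sq_counts n (i # Q) = E * (2 * sq_counts n \<beta> + 4)"
      using sq_counts_exchange[OF ij _ P12 Q12] j by (simp add: P_def Q_def distrib_left[symmetric])
    ultimately have "(hnorm ip (w (j # P)))\<^sup>2 + (hnorm ip (w (i # Q)))\<^sup>2 + 4 * E
        \<le> 2 * (hnorm ip (w \<beta>))\<^sup>2"
      unfolding g_def by (simp add: algebra_simps)
    \<comment> \<open>Bounding twice the product in \<open>upper\<close> by the sum of the two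
      squares and comparing with maximality leaves \<open>4 * E \<le> 2 * E - 2\<close>, impossible
      for positive \<open>E\<close>.\<close>
    with upper sum_squares_bound[of "hnorm ip (w (j # P))" "hnorm ip (w (i # Q))"] E
    show False by linarith
  qed
  then have \<beta>_eq: "\<beta> = replicate k i" using \<beta>n by (metis replicate_length_same)
  have i: "i \<in> {1..n}" using \<beta>n \<beta>_Cons by simp
  have "(hnorm ip (w \<alpha>))\<^sup>2 \<le> g \<alpha>"
    using E by (simp add: g_def sq_counts_def sum_nonneg)
  also have "\<dots> \<le> g \<beta>" by (rule max[OF S(2)])
  also have "\<dots> \<le> e\<^sup>2 + E * (real k)\<^sup>2"
    using power_mono[OF e[OF i], of 2] i by (simp add: g_def \<beta>_eq sq_counts_replicate)
  finally show ?thesis by (simp add: E_def mult.commute)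
qed

text \<open>With \<open>a\<close> the true maximum over words of length \<open>k\<close>, the
  maximum principle becomes a quadratic inequality in which \<open>a\<close> enters the right side
  only linearly. Solving it gives a recursion from length \<open>k - 1\<close> to length
  \<open>k\<close>.\<close>

lemma norm_step:
  assumes k: "k \<ge> 1" and e: "\<And>j. j \<in> {1..n} \<Longrightarrow> hnorm ip (w (replicate k j)) \<le> e" "e \<ge> 0"
    and a': "\<And>\<beta>. set \<beta> \<subseteq> {1..n} \<Longrightarrow> length \<beta> = k - 1 \<Longrightarrow> hnorm ip (w \<beta>) \<le> a'" "a' \<ge> 0"
    and \<alpha>: "set \<alpha> \<subseteq> {1..n}" "length \<alpha> = k"
  shows "hnorm ip (w \<alpha>) \<le> e + real k + 3 * real k ^ 3 * \<kappa> * a'"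
proof -
  define S where "S = {\<beta> \<in> nwords n. length \<beta> = k}"
  define N where "N \<beta> = hnorm ip (w \<beta>)" for \<beta>
  have S: "finite S" "\<alpha> \<in> S" unfolding S_def using finite_nwords \<alpha> by auto
  define a where "a = Max (N ` S)"
  have le_a: "N \<beta> \<le> a" if "\<beta> \<in> S" for \<beta> using that S by (simp add: a_def)
  have "a \<in> N ` S" unfolding a_def using S by (intro Max_in) auto
  then obtain \<beta> where \<beta>: "\<beta> \<in> S" "a = N \<beta>" by auto
  have a_nonneg: "a \<ge> 0" using \<beta> by (simp add: N_def)
  \<comment> \<open>\<open>p\<close> absorbs both squares, as
    \<open>e^2 + k^2 \<le> (e + k)^2\<close>; \<open>q\<close> comes from
    \<open>2 * k + 1 \<le> 3 * k\<close>.\<close>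
  define p q where "p = e + k" and "q = 3 * real k ^ 3 * \<kappa> * a'"
  have nonneg: "p \<ge> 0" "q \<ge> 0" using e a' kappa_ge_1 by (simp_all add: p_def q_def)
  have "a\<^sup>2 \<le> e\<^sup>2 + (real k)\<^sup>2 * ((2 * real k + 1) * \<kappa> * a' * a + 1)"
  proof -
    have "(N \<beta>)\<^sup>2 \<le> e\<^sup>2 + (real k)\<^sup>2 * ((2 * real k + 1) * \<kappa> * a' * a + 1)"
      unfolding N_def using \<beta>(1) le_a
      by (intro maximum_principle k e a') (auto simp: S_def N_def)
    then show ?thesis by (simp add: \<beta>(2))
  qed
  also have "\<dots> \<le> e\<^sup>2 + (real k)\<^sup>2 * (3 * real k * \<kappa> * a' * a + 1)"
    using k a' kappa_ge_1 a_nonneg by (intro add_mono mult_left_mono mult_right_mono) auto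
  also have "\<dots> = e\<^sup>2 + (real k)\<^sup>2 + q * a"
    by (simp add: q_def algebra_simps power2_eq_square power3_eq_cube)
  also have "\<dots> \<le> p\<^sup>2 + q * a" using e by (simp add: p_def power2_sum)
  finally have quad: "a\<^sup>2 \<le> p\<^sup>2 + q * a" .
  have "a \<le> p + q"
  proof (rule ccontr)
    assume "\<not> a \<le> p + q"
    then have gt: "a > p + q" by simp
    then have "p * p \<le> p * a" using nonneg by (intro mult_left_mono) auto
    moreover have "(p + q) * a < a * a" using gt nonneg by (intro mult_strict_right_mono) auto
    ultimately show False using quad by (simp add: power2_eq_square algebra_simps)
  qed
  moreover have "hnorm ip (w \<alpha>) \<le> a" using le_a[OF S(2)] by (simp add: N_def)
  ultimately show ?thesis by (simp add: p_def q_def)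
qed

section \<open>Collecting one letter at the front\<close>

text \<open>Moving the letter \<open>j\<close> to the front: every adjacent swap, and every passage to a term of
its commutator, removes an inversion, and neither increases the number of letters other than
\<open>j\<close>.\<close>

lemma front_normal_form:
  assumes j: "j \<in> {1..n}" and "T \<ge> 0" "y \<ge> 0"
    and front: "\<And>b P. set P \<subseteq> {1..n} \<Longrightarrow> length P \<le> N \<Longrightarrow> b + length P \<le> K \<Longrightarrow>
      cmod (ip (w (replicate b j @ P)) v) \<le> T * y ^ (K - (b + length P))"
    and "set \<gamma> \<subseteq> {1..n}" "length \<gamma> \<le> K" "length (filter (\<lambda>i. i \<noteq> j) \<gamma>) \<le> N"
  shows "cmod (ip (w \<gamma>) v) \<le> T * y ^ (K - length \<gamma>) * (1 + \<kappa> * y) ^ inversions j \<gamma>"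
  using assms(5-7)
proof (induction "inversions j \<gamma>" arbitrary: \<gamma> rule: less_induct)
  case less
  have base: "1 + \<kappa> * y \<ge> 1" using \<open>y \<ge> 0\<close> kappa_ge_1 by simp
  from adjacent_inversion_or_front[of j \<gamma>] show ?case
  proof (elim disjE exE conjE)
    fix b P assume \<gamma>: "\<gamma> = replicate b j @ P" "j \<notin> set P"
    have "filter (\<lambda>i. i \<noteq> j) P = P" using \<gamma>(2) by (auto simp: filter_id_conv)
    then have "length P \<le> N" using less.prems(3) \<gamma>(1) by simp
    then have "cmod (ip (w \<gamma>) v) \<le> T * y ^ (K - length \<gamma>)"
      using front[of P b] less.prems \<gamma> by simp
    also have "\<dots> \<le> T * y ^ (K - length \<gamma>) * (1 + \<kappa> * y) ^ inversions j \<gamma>"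
      using \<open>T \<ge> 0\<close> \<open>y \<ge> 0\<close> mult_left_mono[OF one_le_power[OF base]] by fastforce
    finally show ?thesis .
  next
    fix P i Q assume "i \<noteq> j" and \<gamma>: "\<gamma> = P @ i # j # Q"
    let ?\<gamma>1 = "P @ j # i # Q"
    \<comment> \<open>\<open>d\<close> counts the letters missing from length \<open>K\<close>; a
      commutator term misses one more and so gains another factor \<open>y\<close>.\<close>
    define d V where "d = K - length \<gamma>" and "V = inversions j ?\<gamma>1"
    have inv: "inversions j \<gamma> = Suc V"
      using \<open>i \<noteq> j\<close> by (simp add: \<gamma> V_def inversions_append)
    have invk: "inversions j (P @ k # Q) \<le> V" for k
      using \<open>i \<noteq> j\<close> by (simp add: V_def inversions_append)
    have PQ: "set P \<subseteq> {1..n}" "set Q \<subseteq> {1..n}" "i \<in> {1..n}" using less.prems \<gamma> by auto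
    have 1: "cmod (ip (w ?\<gamma>1) v) \<le> T * y ^ d * (1 + \<kappa> * y) ^ V"
      using less.hyps[of ?\<gamma>1] less.prems inv \<open>i \<noteq> j\<close> by (simp add: V_def d_def \<gamma>)
    have 2: "cmod (ip (w (P @ k # Q)) v) \<le> T * y ^ Suc d * (1 + \<kappa> * y) ^ V" if "k \<in> {1..n}" for k
    proof -
      have "cmod (ip (w (P @ k # Q)) v)
          \<le> T * y ^ (K - length (P @ k # Q)) * (1 + \<kappa> * y) ^ inversions j (P @ k # Q)"
        using invk[of k] inv less.prems that \<open>i \<noteq> j\<close> by (intro less.hyps) (auto simp: \<gamma>)
      also have "K - length (P @ k # Q) = Suc d"
        using less.prems by (simp add: d_def \<gamma>)
      also have "T * y ^ Suc d * (1 + \<kappa> * y) ^ inversions j (P @ k # Q)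
          \<le> T * y ^ Suc d * (1 + \<kappa> * y) ^ V"
        using invk base \<open>T \<ge> 0\<close> \<open>y \<ge> 0\<close> by (intro mult_left_mono power_increasing) auto
      finally show ?thesis .
    qed
    have "cmod (ip (w \<gamma>) v) = cmod (ip (w ?\<gamma>1) v + (\<Sum>k=1..n. c i j k * ip (w (P @ k # Q)) v))"
      using swap[OF PQ j] by (simp add: \<gamma> ip_add_left ip_sum_left ip_smul_left)
    also have "\<dots> \<le> cmod (ip (w ?\<gamma>1) v) + (\<Sum>k=1..n. cmod (c i j k * ip (w (P @ k # Q)) v))"
      by (intro norm_triangle_mono order_refl norm_sum)
    also have "\<dots> \<le> T * y ^ d * (1 + \<kappa> * y) ^ V
        + (\<Sum>k=1..n. cmod (c i j k) * (T * y ^ Suc d * (1 + \<kappa> * y) ^ V))"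
      by (intro add_mono 1 sum_mono) (simp add: norm_mult mult_left_mono 2 del: power_Suc)
    also have "\<dots> \<le> T * y ^ d * (1 + \<kappa> * y) ^ V + \<kappa> * (T * y ^ Suc d * (1 + \<kappa> * y) ^ V)"
      unfolding sum_distrib_right[symmetric] using kappa[OF PQ(3) j] base \<open>T \<ge> 0\<close> \<open>y \<ge> 0\<close>
      by (intro add_left_mono mult_right_mono) auto
    \<comment> \<open>The swapped word and the commutator terms share the power \<open>V\<close>;
      their coefficients add up to \<open>1 + \<kappa> * y\<close>, the factor of the removed
      inversion.\<close>
    also have "\<dots> = T * y ^ (K - length \<gamma>) * (1 + \<kappa> * y) ^ inversions j \<gamma>"
      by (simp add: inv d_def algebra_simps)
    finally show ?thesis .
  qed
qed

section \<open>Crude factorial bound\<close>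

text \<open>By \<open>norm_step\<close>, passing to length \<open>k\<close> costs a factor of order
  \<open>k^3\<close>, and these factors build up the cubed factorial. Its logarithm has order
  \<open>k * ln k\<close>, as the bootstrap asks.\<close>

lemma factorial_bound:
  assumes "log_convex_weight m" and "A \<ge> 1" "C \<ge> 1"
    and pure: "\<And>k j. j \<in> {1..n} \<Longrightarrow> hnorm ip (w (replicate k j)) \<le> C * A ^ k * m k"
  obtains Q where "Q \<ge> 1"
    "\<And>\<alpha>. set \<alpha> \<subseteq> {1..n} \<Longrightarrow>
      hnorm ip (w \<alpha>) \<le> Q ^ Suc (length \<alpha>) * fact (length \<alpha>) ^ 3 * m (length \<alpha>)"
proof -
  interpret log_convex_weight m by fact
  \<comment> \<open>\<open>C\<close>, 1 and \<open>3 * \<kappa>\<close> match the three terms of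
    \<open>norm_step\<close>; \<open>A\<close> dominates the pure powers and the last summand the
    empty word.\<close>
  define Q where "Q = C + 1 + 3 * \<kappa> + A + hnorm ip (w [])"
  have Q: "Q \<ge> 1" "Q \<ge> A" "Q \<ge> C + 1 + 3 * \<kappa>" "Q \<ge> hnorm ip (w [])"
    using assms(2,3) kappa_ge_1 by (auto simp: Q_def)
  have "hnorm ip (w \<alpha>) \<le> Q ^ Suc k * fact k ^ 3 * m k"
    if "set \<alpha> \<subseteq> {1..n}" "length \<alpha> = k" for \<alpha> k
    using that
  proof (induction k arbitrary: \<alpha>)
    case 0
    then show ?case using Q(4) by (simp add: normalized)
  next
    case (Suc k)
    let ?K = "Suc k"
    define F where "F = Q ^ ?K * fact ?K ^ 3 * m ?K"
    have "hnorm ip (w \<alpha>)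
        \<le> C * A ^ ?K * m ?K + real ?K + 3 * real ?K ^ 3 * \<kappa> * (Q ^ ?K * fact k ^ 3 * m k)"
      using Suc.prems Suc.IH Q assms(2,3) pos[of "?K"] pos[of k]
      by (intro norm_step pure) auto
    moreover have "C * A ^ ?K * m ?K \<le> C * F"
    proof -
      have "A ^ ?K * 1 \<le> Q ^ ?K * fact ?K ^ 3"
        using Q assms(2) by (intro mult_mono power_mono one_le_power fact_ge_1) auto
      then show ?thesis
        using assms(3) pos[of ?K] unfolding F_def mult.assoc[symmetric]
        by (intro mult_right_mono) (auto simp: mult.assoc)
    qed
    moreover have "real ?K \<le> F"
    proof -
      have "real ?K \<le> fact ?K" using fact_ge_self[of ?K] of_nat_mono by (metis of_nat_fact)
      also have "\<dots> \<le> fact ?K ^ 3" by (intro self_le_power fact_ge_1) auto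
      finally have "1 * real ?K * 1 \<le> Q ^ ?K * fact ?K ^ 3 * m ?K"
        using Q ge_one[of ?K] by (intro mult_mono one_le_power) auto
      then show ?thesis by (simp add: F_def)
    qed
    moreover have "3 * real ?K ^ 3 * \<kappa> * (Q ^ ?K * fact k ^ 3 * m k) \<le> 3 * \<kappa> * F"
    proof -
      have "m k \<le> m ?K" using supermultiplicative[of 1 k] normalized by simp
      then have "(3 * \<kappa> * Q ^ ?K * fact ?K ^ 3) * m k \<le> (3 * \<kappa> * Q ^ ?K * fact ?K ^ 3) * m ?K"
        using Q kappa_ge_1 by (intro mult_left_mono) auto
      moreover have "(fact ?K :: real) ^ 3 = real ?K ^ 3 * fact k ^ 3"
        by (simp add: power_mult_distrib)
      ultimately show ?thesis by (simp only: F_def mult_ac of_nat_power)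
    qed
    ultimately have "hnorm ip (w \<alpha>) \<le> C * F + F + 3 * \<kappa> * F" by linarith
    also have "\<dots> = (C + 1 + 3 * \<kappa>) * F" by (simp add: algebra_simps)
    also have "\<dots> \<le> Q * F"
      using Q pos[of ?K] by (intro mult_right_mono) (auto simp: F_def)
    finally show ?case by (simp add: F_def mult_ac)
  qed
  then show thesis using that Q(1) by blast
qed

section \<open>From squares to geometric growth\<close>

text \<open>This is the halving step: the square of a norm at length \<open>k\<close> is controlled
  by a single factor \<open>R\<close>, taken from words of length at most \<open>2 - 1 / n\<close>
  times \<open>k\<close>.\<close>

lemma squared_bound:
  assumes m: "log_convex_weight m" and "A \<ge> 1" "C \<ge> 1" "H \<ge> 1" "L \<ge> 1"
    and pure: "\<And>k j. j \<in> {1..n} \<Longrightarrow> hnorm ip (w (replicate k j)) \<le> C * A ^ k * m k"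
    and submult: "\<And>p q. m (p + q) \<le> H ^ (p + q) * m p * m q"
    and growth: "\<And>p. p \<ge> 1 \<Longrightarrow> real p * m (p - 1) \<le> L * m p"
    and n: "n \<ge> 1" and k: "k \<ge> 1" and \<alpha>: "set \<alpha> \<subseteq> {1..n}" "length \<alpha> = k"
    and R: "\<And>\<beta>. set \<beta> \<subseteq> {1..n} \<Longrightarrow> real (length \<beta>) \<le> (2 - 1 / real n) * real k \<Longrightarrow>
      hnorm ip (w \<beta>) \<le> R * m (length \<beta>)"
  shows "(hnorm ip (w \<alpha>))\<^sup>2 \<le> (C * (A\<^sup>2 * exp (2 + 2 * \<kappa> * L) * H\<^sup>2)) ^ k * R * (m k)\<^sup>2"
proof -
  interpret log_convex_weight m by fact
  define K where "K = 2 * k"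
  define \<gamma> where "\<gamma> = rev \<alpha> @ \<alpha>"
  have \<gamma>: "set \<gamma> \<subseteq> {1..n}" "length \<gamma> = K" using \<alpha> by (auto simp: \<gamma>_def K_def)
  obtain j where j: "j \<in> {1..n}" "K \<le> n * count_list \<gamma> j"
    using frequent_letter[OF \<gamma>(1)] n \<gamma>(2) by auto
  define N where "N = length (filter (\<lambda>i. i \<noteq> j) \<gamma>)"
  have "N + count_list \<gamma> j = K"
    using sum_length_filter_compl[of "\<lambda>i. i \<noteq> j" \<gamma>] \<gamma>(2)
    by (simp add: N_def count_list_eq_length_filter eq_commute[of j] cong: filter_cong)
  moreover have "real K / n \<le> count_list \<gamma> j"
    using j(2) n by (simp add: field_simps flip: of_nat_mult)
  ultimately have "real N \<le> real K - real K / n" by linarith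
  \<comment> \<open>The left side is \<open>(2 - 2 / n) * k\<close>. The larger factor
    \<open>2 - 1 / n\<close> is still below 2, and it is at least 1 even for \<open>n = 1\<close>,
    as \<open>bootstrap\<close> demands.\<close>
  also have "\<dots> \<le> (2 - 1 / real n) * real k" by (simp add: K_def field_simps)
  finally have N: "real N \<le> (2 - 1 / real n) * real k" .
  have "R \<ge> 0"
  proof -
    have "0 \<le> (2 - 1 / real n) * real k" using N by linarith
    then show ?thesis using order_trans[OF hnorm_nonneg R[of "[]"]] by (simp add: normalized)
  qed
  \<comment> \<open>\<open>y\<close> is the gain per lost letter from
    \<open>weight_lowering\<close>; \<open>T\<close> collects the factors that do not depend on the
    reordered word.\<close>
  define y T where "y = L / K" and "T = R * C * A ^ K * exp (real K) * m K"
  have y: "y \<ge> 0" and T: "T \<ge> 0"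
    using assms(2-5) \<open>R \<ge> 0\<close> pos[of K] by (auto simp: y_def T_def)
  have front: "cmod (ip (w (replicate b j @ P)) (w [])) \<le> T * y ^ (K - (b + length P))"
    if P: "set P \<subseteq> {1..n}" "length P \<le> N" "b + length P \<le> K" for b P
  proof -
    \<comment> \<open>The block of letters \<open>j\<close> moves to the right factor, where
      \<open>pure\<close> applies; the remaining \<open>P\<close> is short enough for
      \<open>R\<close>.\<close>
    have "cmod (ip (w (replicate b j @ P)) (w [])) = cmod (ip (w P) (w (replicate b j)))"
      using cmod_adjoint_word[of "replicate b j" P "[]"] P j
      by (simp add: set_replicate_conv_if)
    also have "\<dots> \<le> hnorm ip (w P) * hnorm ip (w (replicate b j))" by (rule cauchy_schwarz)
    also have "\<dots> \<le> (R * m (length P)) * (C * A ^ b * m b)"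
      using P N \<open>R \<ge> 0\<close> pos[of "length P"] by (intro mult_mono R pure j) auto
    also have "\<dots> = R * C * (A ^ b * (m b * m (length P)))" by simp
    also have "\<dots> \<le> R * C * (A ^ K * (exp (real K) * y ^ (K - (b + length P)) * m K))"
    proof -
      have "m b * m (length P) \<le> m (b + length P)" by (rule supermultiplicative)
      also have "\<dots> \<le> exp (real K) * y ^ (K - (b + length P)) * m K"
        using weight_lowering[OF assms(5) pos growth, of "K - (b + length P)" K] P(3) k
        by (simp add: y_def K_def)
      finally have prod: "m b * m (length P) \<le> exp (real K) * y ^ (K - (b + length P)) * m K" .
      have pow: "A ^ b \<le> A ^ K" using assms(2) P(3) by (intro power_increasing) auto
      have "A ^ b * (m b * m (length P))
          \<le> A ^ K * (exp (real K) * y ^ (K - (b + length P)) * m K)"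
        by (rule mult_mono[OF pow prod]) (use assms(2) pos[of b] pos[of "length P"] in auto)
      then show ?thesis using assms(3) \<open>R \<ge> 0\<close> by (intro mult_left_mono) auto
    qed
    finally show ?thesis by (simp add: T_def mult_ac)
  qed
  have "(hnorm ip (w \<alpha>))\<^sup>2 = cmod (ip (w \<alpha>) (w \<alpha>))" by (simp add: ip_self norm_power)
  also have "\<dots> = cmod (ip (w \<gamma>) (w []))"
    using cmod_adjoint_word[of "rev \<alpha>" \<alpha> "[]"] \<alpha> by (simp add: \<gamma>_def)
  also have "\<dots> \<le> T * y ^ (K - length \<gamma>) * (1 + \<kappa> * y) ^ inversions j \<gamma>"
    using front_normal_form[OF j(1) T y front \<gamma>(1)] \<gamma>(2) by (simp add: N_def)
  also have "\<dots> = T * (1 + \<kappa> * y) ^ inversions j \<gamma>" using \<gamma>(2) by simp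
  also have "\<dots> \<le> T * exp (2 * \<kappa> * L * k)"
  proof -
    have "(1 + \<kappa> * y) ^ inversions j \<gamma> \<le> (1 + \<kappa> * y) ^ (K * K)"
      using inversions_le[of j \<gamma>] \<gamma>(2) y kappa_ge_1 by (intro power_increasing) auto
    also have "\<dots> \<le> exp (\<kappa> * y) ^ (K * K)"
      using y kappa_ge_1 by (intro power_mono exp_ge_add_one_self) auto
    also have "\<dots> = exp (2 * \<kappa> * L * k)"
      using k by (simp add: exp_of_nat_mult[symmetric] y_def K_def)
    finally show ?thesis using T by (rule mult_left_mono)
  qed
  also have "\<dots> \<le> R * (C ^ k * A ^ K * exp (real K) * (H ^ K * (m k)\<^sup>2)) * exp (2 * \<kappa> * L * k)"
  proof -
    have "m K \<le> H ^ K * (m k)\<^sup>2"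
      using submult[of k k] by (simp add: K_def mult_2 power2_eq_square mult.assoc)
    then have 1: "A ^ K * exp (real K) * m K \<le> A ^ K * exp (real K) * (H ^ K * (m k)\<^sup>2)"
      using assms(2) by (intro mult_left_mono) auto
    \<comment> \<open>As \<open>k \<ge> 1\<close>, the constant can join the geometric
      factor.\<close>
    have 2: "C \<le> C ^ k" using k assms(3) by (intro self_le_power) auto
    have "C * (A ^ K * exp (real K) * m K) \<le> C ^ k * (A ^ K * exp (real K) * (H ^ K * (m k)\<^sup>2))"
      by (rule mult_mono[OF 2 1]) (use assms(2,3) pos[of K] in auto)
    then have "T \<le> R * (C ^ k * A ^ K * exp (real K) * (H ^ K * (m k)\<^sup>2))"
      using \<open>R \<ge> 0\<close> by (simp add: T_def mult.assoc mult_left_mono)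
    then show ?thesis by (rule mult_right_mono) simp
  qed
  also have "exp (real K) = exp 2 ^ k" by (simp add: K_def exp_of_nat_mult[symmetric] mult.commute)
  also have "exp (2 * \<kappa> * L * k) = exp (2 * \<kappa> * L) ^ k"
    by (simp add: exp_of_nat_mult[symmetric] mult.commute)
  also have "R * (C ^ k * A ^ K * exp 2 ^ k * (H ^ K * (m k)\<^sup>2)) * exp (2 * \<kappa> * L) ^ k
      = (C * (A\<^sup>2 * exp (2 + 2 * \<kappa> * L) * H\<^sup>2)) ^ k * R * (m k)\<^sup>2"
    unfolding K_def power_mult exp_add power_mult_distrib by (simp only: mult_ac)
  finally show ?thesis .
qed

text \<open>\<open>bootstrap\<close> iterates the halving step \<open>squared_bound\<close>,
  starting from \<open>factorial_bound\<close>.\<close>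

lemma geometric_bound:
  assumes m: "log_convex_weight m" and "A \<ge> 1" "C \<ge> 1" "H \<ge> 1" "L \<ge> 1"
    and pure: "\<And>k j. j \<in> {1..n} \<Longrightarrow> hnorm ip (w (replicate k j)) \<le> C * A ^ k * m k"
    and submult: "\<And>p q. m (p + q) \<le> H ^ (p + q) * m p * m q"
    and growth: "\<And>p. p \<ge> 1 \<Longrightarrow> real p * m (p - 1) \<le> L * m p"
    and n: "n \<ge> 1"
  obtains a where "\<And>\<alpha>. set \<alpha> \<subseteq> {1..n} \<Longrightarrow> \<alpha> \<noteq> [] \<Longrightarrow>
    hnorm ip (w \<alpha>) \<le> exp 1 * exp a ^ length \<alpha> * m (length \<alpha>)"
proof -
  interpret log_convex_weight m by fact
  obtain Q where Q: "Q \<ge> 1" "\<And>\<alpha>. set \<alpha> \<subseteq> {1..n} \<Longrightarrow>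
      hnorm ip (w \<alpha>) \<le> Q ^ Suc (length \<alpha>) * fact (length \<alpha>) ^ 3 * m (length \<alpha>)"
    using factorial_bound[OF m assms(2,3) pure] by blast
  \<comment> \<open>\<open>s\<close> is the logarithm of a constant valid for all words of length up
    to \<open>x\<close>; \<open>x\<close> is real because \<open>q * x\<close> need not be an
    integer.\<close>
  define B where "B s x \<longleftrightarrow> (\<forall>\<beta>. set \<beta> \<subseteq> {1..n} \<longrightarrow> real (length \<beta>) \<le> x \<longrightarrow>
    hnorm ip (w \<beta>) \<le> exp s * m (length \<beta>))" for s x
  define q where "q = 2 - 1 / real n"
  have q: "1 \<le> q" "q < 2" using n by (auto simp: q_def)
  define M where "M = C * (A\<^sup>2 * exp (2 + 2 * \<kappa> * L) * H\<^sup>2)"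
  have "1 \<le> A\<^sup>2 * exp (2 + 2 * \<kappa> * L) * H\<^sup>2"
  proof -
    have "1 * 1 * 1 \<le> A\<^sup>2 * exp (2 + 2 * \<kappa> * L) * H\<^sup>2"
      using assms(2,4,5) kappa_ge_1 by (intro mult_mono one_le_power) auto
    then show ?thesis by simp
  qed
  then have M: "M \<ge> C" "M \<ge> 1"
    using assms(3) mult_mono[of 1 C 1 "A\<^sup>2 * exp (2 + 2 * \<kappa> * L) * H\<^sup>2"] by (auto simp: M_def)
  have "hnorm ip (w []) \<le> C" using pure[of 1 0] n by (simp add: normalized)
  with M have M0: "hnorm ip (w []) \<le> M" by linarith
  have step: "B ((ln M * x + s) / 2) x" if x: "x \<ge> 1" and B: "B s (q * x)" for s x
    unfolding B_def
  proof (intro allI impI)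
    fix \<beta> assume \<beta>: "set \<beta> \<subseteq> {1..n}" "real (length \<beta>) \<le> x"
    define k where "k = length \<beta>"
    have qk: "q * k \<le> q * x" using q \<beta> by (simp add: k_def)
    have R: "hnorm ip (w \<delta>) \<le> exp s * m (length \<delta>)"
      if "set \<delta> \<subseteq> {1..n}" "real (length \<delta>) \<le> q * k" for \<delta>
      using B that qk unfolding B_def by fastforce
    have "(hnorm ip (w \<beta>))\<^sup>2 \<le> exp (ln M * x) * exp s * (m k)\<^sup>2"
    proof (cases "k = 0")
      case True
      \<comment> \<open>\<open>squared_bound\<close> requires \<open>k \<ge> 1\<close>; the empty
        word is handled directly, with \<open>M \<ge> C\<close> bounding its norm.\<close>
      have "hnorm ip (w []) * hnorm ip (w []) \<le> M * exp s"
        using M0 M R[of "[]"] q by (intro mult_mono) (auto simp: normalized)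
      also have "M = exp (ln M * 1)" using M by simp
      also have "\<dots> \<le> exp (ln M * x)" unfolding exp_le_cancel_iff
        using M x by (intro mult_left_mono) auto
      finally show ?thesis using True by (simp add: k_def power2_eq_square normalized)
    next
      case False
      then have "(hnorm ip (w \<beta>))\<^sup>2 \<le> M ^ k * exp s * (m k)\<^sup>2"
        unfolding M_def using \<beta> R
        by (intro squared_bound[OF assms(1-9)]) (auto simp: k_def q_def Suc_le_eq)
      also have "M ^ k = exp (ln M * k)" using M by (simp add: exp_of_nat2_mult)
      also have "\<dots> * exp s * (m k)\<^sup>2 \<le> exp (ln M * x) * exp s * (m k)\<^sup>2"
        using M \<beta> by (intro mult_right_mono) (auto simp: k_def intro: mult_left_mono)
      finally show ?thesis by simp
    qed
    also have "\<dots> = (exp ((ln M * x + s) / 2) * m k)\<^sup>2"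
      by (simp add: power_mult_distrib exp_double[symmetric] exp_add[symmetric])
    finally show "hnorm ip (w \<beta>) \<le> exp ((ln M * x + s) / 2) * m (length \<beta>)"
      unfolding k_def by (rule power2_le_imp_le) (use pos in \<open>auto intro: less_imp_le\<close>)
  qed
  have apriori: "B ((2 * ln Q + 3) * x * (1 + ln x)) x" if x: "x \<ge> 1" for x
    unfolding B_def
  proof (intro allI impI)
    fix \<beta> assume \<beta>: "set \<beta> \<subseteq> {1..n}" "real (length \<beta>) \<le> x"
    define k where "k = length \<beta>"
    have "Q ^ Suc k = exp (ln Q * real (Suc k))" using Q(1) by (subst exp_of_nat2_mult) auto
    also have "\<dots> \<le> exp (ln Q * (2 * x))"
      unfolding exp_le_cancel_iff using x \<beta> Q(1) by (intro mult_left_mono) (auto simp: k_def)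
    finally have 1: "Q ^ Suc k \<le> exp (ln Q * (2 * x))" .
    have "(fact k :: real) \<le> real k ^ k"
      by (metis fact_le_power of_nat_fact of_nat_power order_refl of_nat_le_iff)
    also have "\<dots> \<le> x ^ k" using \<beta> by (intro power_mono) (auto simp: k_def)
    also have "\<dots> = exp (ln x * k)" using x by (subst exp_of_nat2_mult) auto
    also have "\<dots> \<le> exp (ln x * x)"
      unfolding exp_le_cancel_iff using x \<beta> by (intro mult_left_mono) (auto simp: k_def)
    finally have "(fact k :: real) ^ 3 \<le> exp (ln x * x) ^ 3" by (intro power_mono) auto
    also have "\<dots> = exp (3 * (ln x * x))" by (simp add: exp_of_nat_mult[symmetric])
    finally have 2: "(fact k :: real) ^ 3 \<le> exp (3 * (ln x * x))" .
    have "hnorm ip (w \<beta>) \<le> Q ^ Suc k * fact k ^ 3 * m k" using Q(2)[OF \<beta>(1)] by (simp add: k_def)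
    also have "\<dots> \<le> exp (ln Q * (2 * x)) * exp (3 * (ln x * x)) * m k"
      using pos[of k] by (intro mult_right_mono mult_mono 1 2) auto
    also have "\<dots> \<le> exp ((2 * ln Q + 3) * x * (1 + ln x)) * m k"
    proof -
      have "0 \<le> ln Q * x * ln x" using Q(1) x by simp
      then have "ln Q * (2 * x) + 3 * (ln x * x) \<le> (2 * ln Q + 3) * x * (1 + ln x)"
        using x by (simp add: algebra_simps)
      then show ?thesis using pos[of k] unfolding exp_add[symmetric]
        by (intro mult_right_mono) auto
    qed
    finally show "hnorm ip (w \<beta>) \<le> exp ((2 * ln Q + 3) * x * (1 + ln x)) * m (length \<beta>)"
      by (simp add: k_def)
  qed
  have mono: "B s' x" if "B s x" "s \<le> s'" for s s' x
    unfolding B_def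
  proof (intro allI impI)
    fix \<beta> assume \<beta>: "set \<beta> \<subseteq> {1..n}" "real (length \<beta>) \<le> x"
    have "hnorm ip (w \<beta>) \<le> exp s * m (length \<beta>)" using that(1) \<beta> unfolding B_def by blast
    also have "\<dots> \<le> exp s' * m (length \<beta>)"
      using that(2) pos[of "length \<beta>"] by (intro mult_right_mono) auto
    finally show "hnorm ip (w \<beta>) \<le> exp s' * m (length \<beta>)" .
  qed
  \<comment> \<open>The slope delivered by \<open>bootstrap\<close>; its additive 1 becomes the
    factor \<open>exp 1\<close>.\<close>
  define a where "a = ln M / (2 - q)"
  have "hnorm ip (w \<alpha>) \<le> exp 1 * exp a ^ length \<alpha> * m (length \<alpha>)"
    if \<alpha>: "set \<alpha> \<subseteq> {1..n}" "\<alpha> \<noteq> []" for \<alpha>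
  proof -
    have "1 \<le> length \<alpha>" using \<alpha>(2) by (cases \<alpha>) auto
    then have "B (a * real (length \<alpha>) + 1) (real (length \<alpha>))"
      unfolding a_def using M(2)
      by (intro bootstrap[of q B "ln M", OF q step apriori mono]) auto
    then have "hnorm ip (w \<alpha>) \<le> exp (a * real (length \<alpha>) + 1) * m (length \<alpha>)"
      using \<alpha> unfolding B_def by blast
    also have "exp (a * real (length \<alpha>) + 1) = exp 1 * exp a ^ length \<alpha>"
      by (simp add: exp_add exp_of_nat2_mult)
    finally show ?thesis .
  qed
  then show thesis by (rule that)
qed

end

subsection \<open>Joint and separate regularity\<close>

lemma word_app_replicate: "word_app X (replicate k j) u = (X j ^^ k) u"
  by (induction k) auto

lemma word_app_invariant:
  assumes "\<forall>j\<in>{1..n}. X j ` D \<subseteq> D" "u \<in> D" "set \<alpha> \<subseteq> {1..n}"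
  shows "word_app X \<alpha> u \<in> D"
  using assms(3) by (induction \<alpha>) (use assms(1,2) in \<open>auto simp: image_subset_iff\<close>)

lemma invariant_in_word_dom:
  assumes "\<forall>j\<in>{1..n}. X j ` D \<subseteq> D" "\<forall>j\<in>{1..n}. D \<subseteq> Dom j" "u \<in> D" "set \<alpha> \<subseteq> {1..n}"
  shows "u \<in> word_dom X Dom \<alpha>"
  using assms(4)
proof (induction \<alpha>)
  case (Cons i \<alpha>)
  then show ?case using word_app_invariant[OF assms(1,3), of \<alpha>] assms(2) by auto
qed simp

lemma invariant_in_Cinf_single:
  assumes "T ` D \<subseteq> D" "D \<subseteq> Dm" "u \<in> D"
  shows "u \<in> Cinf_single T Dm"
proof -
  have "word_app (\<lambda>_. T) (replicate k 0) u \<in> D" for k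
    by (induction k) (use assms in auto)
  then have "u \<in> word_dom (\<lambda>_. T) (\<lambda>_. Dm) (replicate k 0)" for k
    by (induction k) (use assms in auto)
  then show ?thesis by (simp add: Cinf_single_def)
qed

text \<open>The commutator relation holds at \<open>word_app X Q u\<close>, a vector of
  \<open>D\<close>, and the letters of \<open>P\<close> are then applied from the inside out. Linear
  combinations are handled in \<open>Dom p\<close>, where \<open>X p\<close> is linear.\<close>

lemma word_app_swap:
  assumes "complex_hilbert_space smul ip"
    and lin: "\<forall>j\<in>{1..n}. linear_op_on smul (Dom j) (X j)"
    and D_dom: "\<forall>j\<in>{1..n}. D \<subseteq> Dom j"
    and D_inv: "\<forall>j\<in>{1..n}. X j ` D \<subseteq> D"
    and comm: "\<forall>v\<in>D. X i (X j v) - X j (X i v) = (\<Sum>k=1..n. smul (c k) (X k v))"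
    and "u \<in> D" "i \<in> {1..n}" "j \<in> {1..n}" "set P \<subseteq> {1..n}" "set Q \<subseteq> {1..n}"
  shows "word_app X (P @ i # j # Q) u
    = word_app X (P @ j # i # Q) u + (\<Sum>k=1..n. smul (c k) (word_app X (P @ k # Q) u))"
  using \<open>set P \<subseteq> {1..n}\<close>
proof (induction P)
  case Nil
  have "word_app X Q u \<in> D" using word_app_invariant[OF D_inv] assms by blast
  with comm show ?case by (simp add: diff_eq_eq add.commute)
next
  case (Cons p P)
  interpret complex_inner smul ip by unfold_locales fact
  have p: "p \<in> {1..n}" using Cons.prems by simp
  have inD: "word_app X (P @ R) u \<in> Dom p" if "set R \<subseteq> {1..n}" for R
  proof -
    have "set (P @ R) \<subseteq> {1..n}" using that Cons.prems by auto
    then show ?thesis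
      using word_app_invariant[of n X D u "P @ R"] D_inv D_dom p \<open>u \<in> D\<close> by auto
  qed
  have sum: "(\<Sum>k=1..n. smul (c k) (word_app X (P @ k # Q) u)) \<in> Dom p \<and>
     X p (\<Sum>k=1..n. smul (c k) (word_app X (P @ k # Q) u))
       = (\<Sum>k=1..n. smul (c k) (X p (word_app X (P @ k # Q) u)))"
    using lin p assms by (intro linear_op_on_sum inD) auto
  have "word_app X (P @ j # i # Q) u \<in> Dom p" using assms by (intro inD) auto
  then have "X p (word_app X (P @ j # i # Q) u + (\<Sum>k=1..n. smul (c k) (word_app X (P @ k # Q) u)))
      = X p (word_app X (P @ j # i # Q) u)
        + X p (\<Sum>k=1..n. smul (c k) (word_app X (P @ k # Q) u))"
    using lin p sum by (intro linear_op_on_add) auto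
  then show ?case using Cons sum by simp
qed

theorem theorem3p1:
  fixes smul :: "complex \<Rightarrow> 'h::ab_group_add \<Rightarrow> 'h"
    and ip :: "'h \<Rightarrow> 'h \<Rightarrow> complex"
    and n :: nat
    and X :: "nat \<Rightarrow> 'h \<Rightarrow> 'h"
    and Dom :: "nat \<Rightarrow> 'h set"
    and D :: "'h set"
    and m :: "nat \<Rightarrow> real"
    and u :: 'h
  assumes hilbert: "complex_hilbert_space smul ip"
    and lin: "\<forall>j\<in>{1..n}. linear_op_on smul (Dom j) (X j)"
    and herm: "\<forall>j\<in>{1..n}. hermitian_on ip (Dom j) (X j) \<or> skew_hermitian_on ip (Dom j) (X j)"
    and D_dom: "\<forall>j\<in>{1..n}. D \<subseteq> Dom j"
    and D_inv: "\<forall>j\<in>{1..n}. X j ` D \<subseteq> D"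
    and m_pos: "\<forall>p. m p > 0"
    and A0: "m 0 = 1 \<and> m 1 = 1"
    and A1: "\<forall>p\<ge>1. (m p)\<^sup>2 \<le> m (p - 1) * m (p + 1)"
    and A2: "\<exists>H>0. \<forall>p q. m (p + q) \<le> H ^ (p + q) * m p * m q"
    and A3': "\<exists>L\<ge>1. \<forall>p\<ge>1. real p * m (p - 1) \<le> L * m p"
    and comm: "\<forall>i\<in>{1..n}. \<forall>j\<in>{1..n}. \<exists>c :: nat \<Rightarrow> complex. \<forall>v\<in>D.
                 X i (X j v) - X j (X i v) = (\<Sum>k=1..n. smul (c k) (X k v))"
    and uD: "u \<in> D"
  shows "u \<in> S_multi ip n X Dom (\<lambda>_. m) \<longleftrightarrow> (\<forall>j\<in>{1..n}. u \<in> S_single ip (X j) (Dom j) m)"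
proof
  assume u: "u \<in> S_multi ip n X Dom (\<lambda>_. m)"
  then obtain A C where AC: "A > 0" "C > 0" "\<And>\<alpha>. \<alpha> \<in> Mwords n \<Longrightarrow>
      hnorm ip (word_app X \<alpha> u) \<le> C * A ^ length \<alpha> * mbold n (\<lambda>_. m) \<alpha>"
    unfolding S_multi_def by blast
  show "\<forall>j\<in>{1..n}. u \<in> S_single ip (X j) (Dom j) m"
  proof
    fix j assume j: "j \<in> {1..n}"
    have "hnorm ip ((X j ^^ k) u) \<le> C * A ^ k * m k" if "k \<ge> 1" for k
    proof -
      have cnt: "count_list (replicate k j) l = (if l = j then k else 0)" for l
        by (induction k) auto
      \<comment> \<open>Absent letters contribute \<open>m 0 = 1\<close>.\<close>
      have "mbold n (\<lambda>_. m) (replicate k j) = (\<Prod>l=1..n. if l = j then m k else 1)"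
        unfolding mbold_def cnt using A0 by (intro prod.cong) auto
      also have "\<dots> = m k" using j by simp
      finally show ?thesis
        using AC(3)[of "replicate k j"] j that by (simp add: Mwords_def word_app_replicate)
    qed
    moreover have "u \<in> Cinf_single (X j) (Dom j)"
      using invariant_in_Cinf_single[of "X j" D "Dom j" u] j D_dom D_inv uD by blast
    ultimately show "u \<in> S_single ip (X j) (Dom j) m"
      unfolding S_single_def using AC(1,2) by blast
  qed
next
  assume u: "\<forall>j\<in>{1..n}. u \<in> S_single ip (X j) (Dom j) m"
  have Cinf: "u \<in> Cinf n X Dom"
    unfolding Cinf_def Mwords_def using invariant_in_word_dom[OF D_inv D_dom uD] by blast
  interpret log_convex_weight m
    using m_pos A0 A1 by unfold_locales auto
  have "\<forall>j\<in>{1..n}. \<exists>A>0. \<exists>C>0. \<forall>k\<ge>1. hnorm ip ((X j ^^ k) u) \<le> C * A ^ k * m k"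
    using u unfolding S_single_def by blast
  from bchoice[OF this] obtain As where As: "\<forall>j\<in>{1..n}. As j > 0 \<and>
      (\<exists>C>0. \<forall>k\<ge>1. hnorm ip ((X j ^^ k) u) \<le> C * As j ^ k * m k)"
    by blast
  then have "\<forall>j\<in>{1..n}. \<exists>C>0. \<forall>k\<ge>1. hnorm ip ((X j ^^ k) u) \<le> C * As j ^ k * m k"
    by blast
  from bchoice[OF this] obtain Cs where Cs: "\<forall>j\<in>{1..n}. Cs j > 0 \<and>
      (\<forall>k\<ge>1. hnorm ip ((X j ^^ k) u) \<le> Cs j * As j ^ k * m k)"
    by blast
  have AC: "\<And>j. j \<in> {1..n} \<Longrightarrow> As j > 0" "\<And>j. j \<in> {1..n} \<Longrightarrow> Cs j > 0"
    "\<And>j k. j \<in> {1..n} \<Longrightarrow> k \<ge> 1 \<Longrightarrow> hnorm ip ((X j ^^ k) u) \<le> Cs j * As j ^ k * m k"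
    using As Cs by simp_all
  define A where "A = 1 + (\<Sum>j=1..n. As j)"
  \<comment> \<open>One constant for all operators; the summand \<open>hnorm ip u\<close> covers the
    power \<open>k = 0\<close>, on which \<open>S_single\<close> says nothing.\<close>
  define C where "C = 1 + hnorm ip u + (\<Sum>j=1..n. Cs j)"
  have hn: "0 \<le> hnorm ip x" for x
    by (rule complex_inner.hnorm_nonneg[OF complex_inner.intro[OF hilbert]])
  have As_le: "As j \<le> A" "Cs j \<le> C" if "j \<in> {1..n}" for j
  proof -
    have "As j \<le> sum As {1..n}" "Cs j \<le> sum Cs {1..n}"
      using AC(1,2) that by (intro member_le_sum less_imp_le; simp)+
    then show "As j \<le> A" "Cs j \<le> C" using hn[of u] by (auto simp: A_def C_def)
  qed
  have "(\<Sum>j=1..n. As j) \<ge> 0" by (rule sum_nonneg) (simp add: AC(1) less_imp_le)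
  then have A: "A \<ge> 1" by (simp add: A_def)
  have "(\<Sum>j=1..n. Cs j) \<ge> 0" by (rule sum_nonneg) (simp add: AC(2) less_imp_le)
  then have C: "C \<ge> 1" "hnorm ip u \<le> C" unfolding C_def using hn[of u] by auto
  have pure: "hnorm ip (word_app X (replicate k j) u) \<le> C * A ^ k * m k" if j: "j \<in> {1..n}" for k j
  proof (cases "k = 0")
    case True
    then show ?thesis using C by (simp add: normalized)
  next
    case False
    then have "hnorm ip (word_app X (replicate k j) u) \<le> Cs j * As j ^ k * m k"
      using AC(3)[OF j] by (simp add: word_app_replicate)
    also have "\<dots> \<le> C * A ^ k * m k"
      using As_le[OF j] AC(1,2)[OF j] C A pos[of k]
      by (intro mult_right_mono mult_mono power_mono) auto
    finally show ?thesis .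
  qed
  obtain H' where H': "H' > 0" "\<And>p q. m (p + q) \<le> H' ^ (p + q) * m p * m q" using A2 by blast
  \<comment> \<open>A base of at least 1 makes powers increase with the exponent, as
    \<open>weight_sum_le\<close> requires.\<close>
  define H where "H = max H' 1"
  have submult: "m (p + q) \<le> H ^ (p + q) * m p * m q" for p q
  proof -
    have "m (p + q) \<le> H' ^ (p + q) * m p * m q" by (rule H'(2))
    also have "\<dots> \<le> H ^ (p + q) * m p * m q"
      using H'(1) pos[of p] pos[of q] by (intro mult_right_mono power_mono) (auto simp: H_def)
    finally show ?thesis .
  qed
  have H: "H \<ge> 1" by (simp add: H_def)
  obtain L where L: "L \<ge> 1" "\<And>p. p \<ge> 1 \<Longrightarrow> real p * m (p - 1) \<le> L * m p" using A3' by blast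
  \<comment> \<open>The structure constants are fixed once for each pair, independently of
    \<open>v\<close>.\<close>
  define c where "c i j = (SOME c :: nat \<Rightarrow> complex. \<forall>v\<in>D.
      X i (X j v) - X j (X i v) = (\<Sum>k=1..n. smul (c k) (X k v)))" for i j
  have c: "\<forall>v\<in>D. X i (X j v) - X j (X i v) = (\<Sum>k=1..n. smul (c i j k) (X k v))"
    if "i \<in> {1..n}" "j \<in> {1..n}" for i j
  proof -
    have "\<exists>c :: nat \<Rightarrow> complex. \<forall>v\<in>D. X i (X j v) - X j (X i v) = (\<Sum>k=1..n. smul (c k) (X k v))"
      using comm that by blast
    then show ?thesis unfolding c_def by (rule someI_ex)
  qed
  define \<kappa> where "\<kappa> = 1 + (\<Sum>i=1..n. \<Sum>j=1..n. \<Sum>k=1..n. cmod (c i j k))"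
  define eps :: "nat \<Rightarrow> complex" where "eps i = (if hermitian_on ip (Dom i) (X i) then 1 else - 1)" for i
  interpret lie_words smul ip n "\<lambda>\<alpha>. word_app X \<alpha> u" c eps \<kappa>
  proof unfold_locales
    show "complex_hilbert_space smul ip" by fact
  next
    fix P Q i j assume "set P \<subseteq> {1..n}" "set Q \<subseteq> {1..n}" "i \<in> {1..n}" "j \<in> {1..n}"
    then show "word_app X (P @ i # j # Q) u
        = word_app X (P @ j # i # Q) u + (\<Sum>k=1..n. smul (c i j k) (word_app X (P @ k # Q) u))"
      using word_app_swap[OF hilbert lin D_dom D_inv c uD] by blast
  next
    fix i P Q assume i: "i \<in> {1..n}" and "set P \<subseteq> {1..n}" "set Q \<subseteq> {1..n}"
    then have "word_app X P u \<in> Dom i" "word_app X Q u \<in> Dom i"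
      using word_app_invariant[OF D_inv uD] D_dom by blast+
    moreover have "skew_hermitian_on ip (Dom i) (X i)" if "\<not> hermitian_on ip (Dom i) (X i)"
      using herm i that by blast
    ultimately show "ip (word_app X (i # P) u) (word_app X Q u)
        = eps i * ip (word_app X P u) (word_app X (i # Q) u)"
      unfolding eps_def
      by (cases "hermitian_on ip (Dom i) (X i)")
        (simp add: hermitian_on_def, simp add: skew_hermitian_on_def)
  next
    fix i j assume i: "i \<in> {1..n}" and j: "j \<in> {1..n}"
    have "(\<Sum>k=1..n. cmod (c i j k)) \<le> (\<Sum>j=1..n. \<Sum>k=1..n. cmod (c i j k))"
      using j by (intro member_le_sum) (auto intro!: sum_nonneg)
    also have "\<dots> \<le> (\<Sum>i=1..n. \<Sum>j=1..n. \<Sum>k=1..n. cmod (c i j k))"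
      using i by (intro member_le_sum) (auto intro!: sum_nonneg)
    finally show "(\<Sum>k=1..n. cmod (c i j k)) \<le> \<kappa>" by (simp add: \<kappa>_def)
  next
    show "\<kappa> \<ge> 1" unfolding \<kappa>_def by (simp add: sum_nonneg)
  qed (simp add: eps_def)
  show "u \<in> S_multi ip n X Dom (\<lambda>_. m)"
  proof (cases "n = 0")
    case True
    \<comment> \<open>Without operators there are no words, so the estimate is vacuous;
      \<open>geometric_bound\<close> covers \<open>n \<ge> 1\<close>.\<close>
    then have "Mwords n = {}" by (auto simp: Mwords_def)
    then show ?thesis using Cinf by (auto simp: S_multi_def intro: exI[of _ 1])
  next
    case False
    then obtain a where a: "\<And>\<alpha>. set \<alpha> \<subseteq> {1..n} \<Longrightarrow> \<alpha> \<noteq> [] \<Longrightarrow>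
        hnorm ip (word_app X \<alpha> u) \<le> exp 1 * exp a ^ length \<alpha> * m (length \<alpha>)"
      using geometric_bound[OF log_convex_weight_axioms A C(1) H L(1) pure submult L(2)] by auto
    \<comment> \<open>The factor \<open>H ^ n\<close> per letter pays for splitting
      \<open>m (length \<alpha>)\<close> into the weights of the \<open>n\<close> letter
      counts.\<close>
    have "hnorm ip (word_app X \<alpha> u) \<le> exp 1 * (exp a * H ^ n) ^ length \<alpha> * mbold n (\<lambda>_. m) \<alpha>"
      if "\<alpha> \<in> Mwords n" for \<alpha>
    proof -
      have \<alpha>: "set \<alpha> \<subseteq> {1..n}" "\<alpha> \<noteq> []" using that by (auto simp: Mwords_def)
      have len: "(\<Sum>l=1..n. count_list \<alpha> l) = length \<alpha>" using sum_count_set[OF \<alpha>(1)] by simp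
      have "m (length \<alpha>) \<le> H ^ (n * length \<alpha>) * mbold n (\<lambda>_. m) \<alpha>"
        using weight_sum_le[OF H pos normalized(1) submult, of "{1..n}" "count_list \<alpha>"]
        by (simp add: len[simplified] mbold_def)
      then have "exp 1 * exp a ^ length \<alpha> * m (length \<alpha>)
          \<le> exp 1 * exp a ^ length \<alpha> * (H ^ (n * length \<alpha>) * mbold n (\<lambda>_. m) \<alpha>)"
        by (intro mult_left_mono) auto
      also have "\<dots> = exp 1 * (exp a * H ^ n) ^ length \<alpha> * mbold n (\<lambda>_. m) \<alpha>"
        by (simp add: power_mult_distrib power_mult)
      finally show ?thesis using a[OF \<alpha>] by linarith
    qed
    moreover have "exp a * H ^ n > 0" using H by simp
    ultimately show ?thesis unfolding S_multi_def using Cinf exp_gt_zero[of "1::real"] by blast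
  qed
qed

end
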